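(* Let $(\Omega,\Sigma,\mu)$ be a localizable measure space. The following statements are equivalent: (i) $\mu$ is atomless; (ii) $L_1(\mu)$ has the SD2P; (iii) $L_1(\mu)$ has the 1-ASD2P$_\omega$; (iv) the closed unit ball $B_{L_1(\mu)}$ has no strongly exposed points; (v) $L_1(\mu)$ has the Daugavet property; (vi) $L_\infty(\mu)$ is octahedral; (vii) $L_\infty(\mu)$ fails the $(-1)$-BCP$_\omega$; (viii) $L_\infty(\mu)$ has the Daugavet property.
   Context: Banach spaces are real and infinite-dimensional (in particular $L_1(\mu)$ is assumed infinite-dimensional). $B_X$, $S_X$ are the closed unit ball and unit sphere of $X$. A measure $\mu$ is localizable if and only if $L_1(\mu)^*=L_\infty(\mu)$ via the canonical duality. A slice of $B_X$ is a set $\{x\in B_X:x^*(x)\ge1-\varepsilon\}$ with $x^*\in S_{X^*}$ and $\varepsilon\in(0,1)$. $X$ has the SD2P if every finite convex combination $\sum_{i=1}^n\lambda_iS_i$ ($\lambda_i\ge0$, $\sum_i\lambda_i=1$) of slices of $B_X$ intersects $B_X\setminus\lambda B_X$ for every $\lambda\in(0,1)$. For $B\subset X$ and $A\subset X^*$, $B$ norms $A$ if for every $\lambda\in(0,1)$ and every $x^*\in A$ there is $x\in B\setminus\{0\}$ with $x^*(x)\ge\lambda\|x^*\|\|x\|$. $X$ has the 1-ASD2P$_\omega$ if for every countable set $A\subset S_{X^*}$ there are $B\subset S_X$ and $x^*\in S_{X^*}$ such that $B$ norms $A$ and $x^*(x)=1$ for every $x\in B$. (Equivalently, every convex series of slices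 of $B_X$ intersects $S_X$.) $X$ has the Daugavet property if $\|I+T\|=1+\|T\|$ for every rank-1 bounded linear operator $T:X\to X$. $X$ is octahedral if for every finite-dimensional subspace $Y\subset X$ and $\varepsilon>0$ there is $x\in S_X$ such that $\|y+\lambda x\|\ge(1-\varepsilon)(\|y\|+|\lambda|)$ for all $y\in Y$, $\lambda\in\mathbb R$. $X$ fails the $(-1)$-BCP$_\omega$ if for every separable subspace $Y\subset X$ there is $x\in S_X$ such that $\|y+\lambda x\|\ge\|y\|+|\lambda|$ for all $y\in Y$, $\lambda\in\mathbb R$. *)

theory Defs
  imports "HOL-Probability.Probability"
begin

section \<open>Real normed spaces with an explicit carrier\<close>

text \<open>
  The spaces L1 and Linf depend on a measure, that is on a value, so they cannot be types of a
  type class; normed spaces are therefore records with a carrier set.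
\<close>

record 'v nspace =
  vecs :: "'v set"
  vadd :: "'v \<Rightarrow> 'v \<Rightarrow> 'v"
  vscale :: "real \<Rightarrow> 'v \<Rightarrow> 'v"
  vzero :: "'v"
  vnorm :: "'v \<Rightarrow> real"

locale real_normed_space =
  fixes X :: "'v nspace"
  assumes add_closed: "\<lbrakk>x \<in> vecs X; y \<in> vecs X\<rbrakk> \<Longrightarrow> vadd X x y \<in> vecs X"
    and scale_closed: "x \<in> vecs X \<Longrightarrow> vscale X c x \<in> vecs X"
    and zero_closed: "vzero X \<in> vecs X"
    and add_assoc: "\<lbrakk>x \<in> vecs X; y \<in> vecs X; z \<in> vecs X\<rbrakk>
      \<Longrightarrow> vadd X (vadd X x y) z = vadd X x (vadd X y z)"
    and add_commute: "\<lbrakk>x \<in> vecs X; y \<in> vecs X\<rbrakk> \<Longrightarrow> vadd X x y = vadd X y x"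
    and add_zero: "x \<in> vecs X \<Longrightarrow> vadd X x (vzero X) = x"
    and add_inverse: "x \<in> vecs X \<Longrightarrow> vadd X x (vscale X (-1) x) = vzero X"
    and scale_add: "\<lbrakk>x \<in> vecs X; y \<in> vecs X\<rbrakk>
      \<Longrightarrow> vscale X c (vadd X x y) = vadd X (vscale X c x) (vscale X c y)"
    and add_scale: "x \<in> vecs X \<Longrightarrow> vscale X (c + d) x = vadd X (vscale X c x) (vscale X d x)"
    and scale_scale: "x \<in> vecs X \<Longrightarrow> vscale X c (vscale X d x) = vscale X (c * d) x"
    and scale_one: "x \<in> vecs X \<Longrightarrow> vscale X 1 x = x"
    and norm_zero_iff: "x \<in> vecs X \<Longrightarrow> vnorm X x = 0 \<longleftrightarrow> x = vzero X"
    and norm_scale: "x \<in> vecs X \<Longrightarrow> vnorm X (vscale X c x) = \<bar>c\<bar> * vnorm X x"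
    and norm_triangle: "\<lbrakk>x \<in> vecs X; y \<in> vecs X\<rbrakk>
      \<Longrightarrow> vnorm X (vadd X x y) \<le> vnorm X x + vnorm X y"

definition vsub :: "'v nspace \<Rightarrow> 'v \<Rightarrow> 'v \<Rightarrow> 'v" where
  "vsub X x y = vadd X x (vscale X (-1) y)"

definition unit_ball :: "'v nspace \<Rightarrow> 'v set" where
  "unit_ball X = {x \<in> vecs X. vnorm X x \<le> 1}"

definition unit_sphere :: "'v nspace \<Rightarrow> 'v set" where
  "unit_sphere X = {x \<in> vecs X. vnorm X x = 1}"

definition lin_subspace :: "'v nspace \<Rightarrow> 'v set \<Rightarrow> bool" where
  "lin_subspace X Y \<longleftrightarrow> Y \<subseteq> vecs X \<and> vzero X \<in> Y \<and>
     (\<forall>x\<in>Y. \<forall>y\<in>Y. vadd X x y \<in> Y) \<and> (\<forall>c. \<forall>x\<in>Y. vscale X c x \<in> Y)"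

definition lin_span :: "'v nspace \<Rightarrow> 'v set \<Rightarrow> 'v set" where
  "lin_span X F = \<Inter>{Y. lin_subspace X Y \<and> F \<subseteq> Y}"

definition fin_dim :: "'v nspace \<Rightarrow> 'v set \<Rightarrow> bool" where
  "fin_dim X Y \<longleftrightarrow> (\<exists>F. finite F \<and> F \<subseteq> Y \<and> lin_span X F = Y)"

definition separable_in :: "'v nspace \<Rightarrow> 'v set \<Rightarrow> bool" where
  "separable_in X Y \<longleftrightarrow>
     (\<exists>D. countable D \<and> D \<subseteq> Y \<and> (\<forall>y\<in>Y. \<forall>e>0. \<exists>d\<in>D. vnorm X (vsub X y d) < e))"

definition lin_map :: "'v nspace \<Rightarrow> 'w nspace \<Rightarrow> ('v \<Rightarrow> 'w) \<Rightarrow> bool" where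
  "lin_map X Y T \<longleftrightarrow> (\<forall>x\<in>vecs X. T x \<in> vecs Y) \<and>
     (\<forall>x\<in>vecs X. \<forall>y\<in>vecs X. T (vadd X x y) = vadd Y (T x) (T y)) \<and>
     (\<forall>c. \<forall>x\<in>vecs X. T (vscale X c x) = vscale Y c (T x))"

definition bdd_lin_map :: "'v nspace \<Rightarrow> 'w nspace \<Rightarrow> ('v \<Rightarrow> 'w) \<Rightarrow> bool" where
  "bdd_lin_map X Y T \<longleftrightarrow> lin_map X Y T \<and> (\<exists>K. \<forall>x\<in>vecs X. vnorm Y (T x) \<le> K * vnorm X x)"

definition op_norm :: "'v nspace \<Rightarrow> 'w nspace \<Rightarrow> ('v \<Rightarrow> 'w) \<Rightarrow> real" where
  "op_norm X Y T = (SUP x\<in>unit_ball X. vnorm Y (T x))"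

definition isometric_isomorphism :: "'v nspace \<Rightarrow> 'w nspace \<Rightarrow> ('v \<Rightarrow> 'w) \<Rightarrow> bool" where
  "isometric_isomorphism X Y T \<longleftrightarrow> lin_map X Y T \<and> bij_betw T (vecs X) (vecs Y) \<and>
     (\<forall>x\<in>vecs X. vnorm Y (T x) = vnorm X x)"

definition real_line :: "real nspace" where
  "real_line = \<lparr>vecs = UNIV, vadd = (+), vscale = (*), vzero = 0, vnorm = abs\<rparr>"

text \<open>Functionals are extensional, so that two of them are equal iff they agree on the carrier.\<close>

definition dual_space :: "'v nspace \<Rightarrow> ('v \<Rightarrow> real) nspace" where
  "dual_space X = \<lparr>
     vecs = {p \<in> extensional (vecs X). bdd_lin_map X real_line p},
     vadd = (\<lambda>p q. \<lambda>x\<in>vecs X. p x + q x),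
     vscale = (\<lambda>c p. \<lambda>x\<in>vecs X. c * p x),
     vzero = (\<lambda>x\<in>vecs X. 0),
     vnorm = op_norm X real_line\<rparr>"


section \<open>Geometric properties\<close>

definition slices :: "'v nspace \<Rightarrow> 'v set set" where
  "slices X = {{x \<in> unit_ball X. p x \<ge> 1 - e} | p e.
     p \<in> unit_sphere (dual_space X) \<and> 0 < e \<and> e < 1}"

primrec lin_comb :: "'v nspace \<Rightarrow> (nat \<Rightarrow> real) \<Rightarrow> (nat \<Rightarrow> 'v) \<Rightarrow> nat \<Rightarrow> 'v" where
  "lin_comb X c x 0 = vzero X"
| "lin_comb X c x (Suc n) = vadd X (lin_comb X c x n) (vscale X (c n) (x n))"

definition SD2P :: "'v nspace \<Rightarrow> bool" where
  "SD2P X \<longleftrightarrow> (\<forall>n c S.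
     (\<forall>i<n. c i \<ge> 0 \<and> S i \<in> slices X) \<and> (\<Sum>i<n. c i) = 1 \<longrightarrow>
     (\<forall>r. 0 < r \<and> r < 1 \<longrightarrow>
       {lin_comb X c x n | x. \<forall>i<n. x i \<in> S i} \<inter> (unit_ball X - vscale X r ` unit_ball X) \<noteq> {}))"

definition norms_functionals :: "'v nspace \<Rightarrow> 'v set \<Rightarrow> ('v \<Rightarrow> real) set \<Rightarrow> bool" where
  "norms_functionals X B A \<longleftrightarrow> (\<forall>r p. 0 < r \<and> r < 1 \<and> p \<in> A \<longrightarrow>
     (\<exists>x\<in>B - {vzero X}. p x \<ge> r * vnorm (dual_space X) p * vnorm X x))"

text \<open>Here \<open>countable\<close> includes finite sets.\<close>

definition one_ASD2P_omega :: "'v nspace \<Rightarrow> bool" where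
  "one_ASD2P_omega X \<longleftrightarrow> (\<forall>A. countable A \<and> A \<subseteq> unit_sphere (dual_space X) \<longrightarrow>
     (\<exists>B p. B \<subseteq> unit_sphere X \<and> p \<in> unit_sphere (dual_space X) \<and>
        norms_functionals X B A \<and> (\<forall>x\<in>B. p x = 1)))"

definition strongly_exposed_point :: "'v nspace \<Rightarrow> 'v set \<Rightarrow> 'v \<Rightarrow> bool" where
  "strongly_exposed_point X C x \<longleftrightarrow> x \<in> C \<and>
     (\<exists>p\<in>vecs (dual_space X).
        (\<forall>y\<in>C. y \<noteq> x \<longrightarrow> p y < p x) \<and>
        (\<forall>s. (\<forall>n. s n \<in> C) \<and> (\<lambda>n::nat. p (s n)) \<longlonglongrightarrow> p x \<longrightarrow>
             (\<lambda>n. vnorm X (vsub X (s n) x)) \<longlonglongrightarrow> 0))"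

definition rank_one :: "'v nspace \<Rightarrow> 'w nspace \<Rightarrow> ('v \<Rightarrow> 'w) \<Rightarrow> bool" where
  "rank_one X Y T \<longleftrightarrow>
     (\<exists>v\<in>vecs Y. v \<noteq> vzero Y \<and> T ` vecs X = range (\<lambda>c. vscale Y c v))"

definition Daugavet :: "'v nspace \<Rightarrow> bool" where
  "Daugavet X \<longleftrightarrow> (\<forall>T. bdd_lin_map X X T \<and> rank_one X X T \<longrightarrow>
     op_norm X X (\<lambda>x. vadd X x (T x)) = 1 + op_norm X X T)"

definition octahedral :: "'v nspace \<Rightarrow> bool" where
  "octahedral X \<longleftrightarrow> (\<forall>Y e. lin_subspace X Y \<and> fin_dim X Y \<and> e > 0 \<longrightarrow>
     (\<exists>x\<in>unit_sphere X. \<forall>y\<in>Y. \<forall>l.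
        vnorm X (vadd X y (vscale X l x)) \<ge> (1 - e) * (vnorm X y + \<bar>l\<bar>)))"

definition fails_m1_BCP_omega :: "'v nspace \<Rightarrow> bool" where
  "fails_m1_BCP_omega X \<longleftrightarrow> (\<forall>Y. lin_subspace X Y \<and> separable_in X Y \<longrightarrow>
     (\<exists>x\<in>unit_sphere X. \<forall>y\<in>Y. \<forall>l.
        vnorm X (vadd X y (vscale X l x)) \<ge> vnorm X y + \<bar>l\<bar>))"


section \<open>The spaces of integrable and of essentially bounded functions\<close>

text \<open>
  Vectors are classes of a.e. equal measurable functions. The operations below are stated through
  a chosen representative; the lemmas at the end show that they do not depend on the choice.
\<close>

definition ae_class :: "'a measure \<Rightarrow> ('a \<Rightarrow> real) \<Rightarrow> ('a \<Rightarrow> real) set" where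
  "ae_class M f = {g \<in> borel_measurable M. AE x in M. g x = f x}"

definition rep :: "('a \<Rightarrow> real) set \<Rightarrow> 'a \<Rightarrow> real" where
  "rep u = (SOME f. f \<in> u)"

definition L1 :: "'a measure \<Rightarrow> ('a \<Rightarrow> real) set nspace" where
  "L1 M = \<lparr>
     vecs = ae_class M ` {f. integrable M f},
     vadd = (\<lambda>u v. ae_class M (\<lambda>x. rep u x + rep v x)),
     vscale = (\<lambda>c u. ae_class M (\<lambda>x. c * rep u x)),
     vzero = ae_class M (\<lambda>x. 0),
     vnorm = (\<lambda>u. LINT x|M. \<bar>rep u x\<bar>)\<rparr>"

definition Linf :: "'a measure \<Rightarrow> ('a \<Rightarrow> real) set nspace" where
  "Linf M = \<lparr>
     vecs = ae_class M ` {f \<in> borel_measurable M. esssup M (\<lambda>x. ereal \<bar>f x\<bar>) < \<infinity>},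
     vadd = (\<lambda>u v. ae_class M (\<lambda>x. rep u x + rep v x)),
     vscale = (\<lambda>c u. ae_class M (\<lambda>x. c * rep u x)),
     vzero = ae_class M (\<lambda>x. 0),
     vnorm = (\<lambda>u. real_of_ereal (esssup M (\<lambda>x. ereal \<bar>rep u x\<bar>)))\<rparr>"

definition canonical_duality ::
    "'a measure \<Rightarrow> ('a \<Rightarrow> real) set \<Rightarrow> ('a \<Rightarrow> real) set \<Rightarrow> real" where
  "canonical_duality M v = (\<lambda>u\<in>vecs (L1 M). LINT x|M. rep u x * rep v x)"

text \<open>
  A measure is localizable iff the dual of L1 is Linf via the canonical duality; this is taken as
  the definition. It implies that the measure is semifinite.
\<close>

definition localizable :: "'a measure \<Rightarrow> bool" where
  "localizable M \<longleftrightarrow> isometric_isomorphism (Linf M) (dual_space (L1 M)) (canonical_duality M)"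

definition atom :: "'a measure \<Rightarrow> 'a set \<Rightarrow> bool" where
  "atom M A \<longleftrightarrow> A \<in> sets M \<and> emeasure M A > 0 \<and>
     (\<forall>B\<in>sets M. B \<subseteq> A \<longrightarrow> emeasure M B = 0 \<or> emeasure M (A - B) = 0)"

definition atomless :: "'a measure \<Rightarrow> bool" where
  "atomless M \<longleftrightarrow> (\<nexists>A. atom M A)"


section \<open>The records above are normed spaces\<close>

lemma mem_ae_class: "f \<in> borel_measurable M \<Longrightarrow> f \<in> ae_class M f"
  by (simp add: ae_class_def)

lemma ae_class_eq_iff:
  assumes "f \<in> borel_measurable M"
  shows "ae_class M f = ae_class M g \<longleftrightarrow> (AE x in M. f x = g x)"
proof
  assume "ae_class M f = ae_class M g"
  with mem_ae_class[OF assms] show "AE x in M. f x = g x"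
    by (auto simp: ae_class_def)
next
  assume *: "AE x in M. f x = g x"
  have "(AE x in M. h x = f x) \<longleftrightarrow> (AE x in M. h x = g x)" for h
    using * by (auto elim!: eventually_elim2)
  then show "ae_class M f = ae_class M g"
    by (auto simp: ae_class_def)
qed

lemma rep_ae_class:
  assumes "f \<in> borel_measurable M"
  shows "rep (ae_class M f) \<in> borel_measurable M" "AE x in M. rep (ae_class M f) x = f x"
proof -
  have "rep (ae_class M f) \<in> ae_class M f"
    unfolding rep_def using mem_ae_class[OF assms] by (rule someI[where P = "\<lambda>g. g \<in> ae_class M f"])
  then show "rep (ae_class M f) \<in> borel_measurable M" "AE x in M. rep (ae_class M f) x = f x"
    by (auto simp: ae_class_def)
qed

lemma ae_class_rep: "f \<in> borel_measurable M \<Longrightarrow> ae_class M (rep (ae_class M f)) = ae_class M f"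
  using rep_ae_class[of f M] by (subst ae_class_eq_iff) auto

lemma ae_class_rep_add:
  assumes [measurable]: "f \<in> borel_measurable M" "g \<in> borel_measurable M"
  shows "ae_class M (\<lambda>x. rep (ae_class M f) x + rep (ae_class M g) x) = ae_class M (\<lambda>x. f x + g x)"
proof -
  note [measurable] = rep_ae_class(1)[OF assms(1)] rep_ae_class(1)[OF assms(2)]
  have "AE x in M. rep (ae_class M f) x + rep (ae_class M g) x = f x + g x"
    using rep_ae_class(2)[OF assms(1)] rep_ae_class(2)[OF assms(2)] by eventually_elim simp
  then show ?thesis by (simp add: ae_class_eq_iff)
qed

lemma ae_class_rep_scale:
  assumes [measurable]: "f \<in> borel_measurable M"
  shows "ae_class M (\<lambda>x. c * rep (ae_class M f) x) = ae_class M (\<lambda>x. c * f x)"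
proof -
  note [measurable] = rep_ae_class(1)[OF assms]
  have "AE x in M. c * rep (ae_class M f) x = c * f x"
    using rep_ae_class(2)[OF assms] by eventually_elim simp
  then show ?thesis by (simp add: ae_class_eq_iff)
qed

lemma integral_abs_rep:
  assumes [measurable]: "f \<in> borel_measurable M"
  shows "(LINT x|M. \<bar>rep (ae_class M f) x\<bar>) = (LINT x|M. \<bar>f x\<bar>)"
proof -
  note [measurable] = rep_ae_class(1)[OF assms]
  have "AE x in M. \<bar>rep (ae_class M f) x\<bar> = \<bar>f x\<bar>"
    using rep_ae_class(2)[OF assms] by eventually_elim simp
  then show ?thesis by (intro integral_cong_AE) simp_all
qed

lemma esssup_abs_rep:
  assumes [measurable]: "f \<in> borel_measurable M"
  shows "esssup M (\<lambda>x. ereal \<bar>rep (ae_class M f) x\<bar>) = esssup M (\<lambda>x. ereal \<bar>f x\<bar>)"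
proof -
  note [measurable] = rep_ae_class(1)[OF assms]
  have "AE x in M. ereal \<bar>rep (ae_class M f) x\<bar> = ereal \<bar>f x\<bar>"
    using rep_ae_class(2)[OF assms] by eventually_elim simp
  then show ?thesis by (intro esssup_AE_cong) simp_all
qed

lemma real_normed_space_L1: "real_normed_space (L1 M)"
proof -
  have E: "\<exists>f. integrable M f \<and> f \<in> borel_measurable M \<and> u = ae_class M f"
    if "u \<in> vecs (L1 M)" for u
    using that by (auto simp: L1_def)
  have I: "ae_class M f \<in> vecs (L1 M)" if "integrable M f" for f
    using that by (auto simp: L1_def)
  have N: "vnorm (L1 M) (ae_class M f) = (LINT x|M. \<bar>f x\<bar>)" if "f \<in> borel_measurable M" for f
    using that by (simp add: L1_def integral_abs_rep)
  have A: "vadd (L1 M) (ae_class M f) (ae_class M g) = ae_class M (\<lambda>x. f x + g x)"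
    if "f \<in> borel_measurable M" "g \<in> borel_measurable M" for f g
    using that by (simp add: L1_def ae_class_rep_add)
  have S: "vscale (L1 M) c (ae_class M f) = ae_class M (\<lambda>x. c * f x)"
    if "f \<in> borel_measurable M" for f c
    using that by (simp add: L1_def ae_class_rep_scale)
  have Z: "vzero (L1 M) = ae_class M (\<lambda>x. 0)" by (simp add: L1_def)
  show ?thesis
  proof (standard, goal_cases)
    case (12 u)
    then obtain f where f: "integrable M f" "f \<in> borel_measurable M" "u = ae_class M f"
      using E by metis
    then have "vnorm (L1 M) u = 0 \<longleftrightarrow> (AE x in M. f x = 0)"
      using integral_nonneg_eq_0_iff_AE[of M "\<lambda>x. \<bar>f x\<bar>"] by (simp add: N)
    with f show ?case by (simp add: Z ae_class_eq_iff)
  next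
    case (14 u v)
    then obtain f g where f: "integrable M f" "f \<in> borel_measurable M" "u = ae_class M f"
      and g: "integrable M g" "g \<in> borel_measurable M" "v = ae_class M g"
      using E by metis
    then have "(LINT x|M. \<bar>f x + g x\<bar>) \<le> (LINT x|M. \<bar>f x\<bar> + \<bar>g x\<bar>)"
      by (intro integral_mono) auto
    with f g show ?case by (simp add: A N)
  qed (auto dest!: E simp: A S Z N I algebra_simps abs_mult)
qed

lemma esssup_abs_bound:
  assumes [measurable]: "f \<in> borel_measurable M" and "esssup M (\<lambda>x. ereal \<bar>f x\<bar>) < \<infinity>"
  shows "AE x in M. \<bar>f x\<bar> \<le> real_of_ereal (esssup M (\<lambda>x. ereal \<bar>f x\<bar>))"
  using esssup_AE[where f = "\<lambda>x. ereal \<bar>f x\<bar>" and M = M]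
proof eventually_elim
  case (elim x)
  with assms(2) show ?case by (cases "esssup M (\<lambda>x. ereal \<bar>f x\<bar>)") auto
qed

lemma esssup_abs_leI:
  assumes [measurable]: "f \<in> borel_measurable M" and "AE x in M. \<bar>f x\<bar> \<le> C" "0 \<le> C"
  shows "esssup M (\<lambda>x. ereal \<bar>f x\<bar>) < \<infinity>" "real_of_ereal (esssup M (\<lambda>x. ereal \<bar>f x\<bar>)) \<le> C"
proof -
  have *: "esssup M (\<lambda>x. ereal \<bar>f x\<bar>) \<le> ereal C" using assms by (intro esssup_I) auto
  then show "esssup M (\<lambda>x. ereal \<bar>f x\<bar>) < \<infinity>" by (rule le_less_trans) simp
  show "real_of_ereal (esssup M (\<lambda>x. ereal \<bar>f x\<bar>)) \<le> C"
    using * assms(3) by (cases "esssup M (\<lambda>x. ereal \<bar>f x\<bar>)") auto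
qed

lemma esssup_abs_nonneg: "0 \<le> real_of_ereal (esssup M (\<lambda>x. ereal \<bar>f x\<bar>))"
proof (cases "(\<lambda>x. ereal \<bar>f x\<bar>) \<in> borel_measurable M \<and> emeasure M (space M) \<noteq> 0")
  case True
  then have "esssup M (\<lambda>x. 0::ereal) \<le> esssup M (\<lambda>x. ereal \<bar>f x\<bar>)" by (intro esssup_mono) auto
  then show ?thesis using True by (simp add: esssup_const real_of_ereal_pos)
next
  case False
  then have "esssup M (\<lambda>x. ereal \<bar>f x\<bar>) = top \<or> esssup M (\<lambda>x. ereal \<bar>f x\<bar>) = - \<infinity>"
    using esssup_zero_space esssup_non_measurable by blast
  then show ?thesis by (auto simp: top_ereal_def)
qed

lemma Linf_vecs_iff:
  assumes [measurable]: "f \<in> borel_measurable M"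
  shows "ae_class M f \<in> vecs (Linf M) \<longleftrightarrow> (\<exists>C. AE x in M. \<bar>f x\<bar> \<le> C)"
proof
  assume "ae_class M f \<in> vecs (Linf M)"
  then obtain g where g: "g \<in> borel_measurable M" "esssup M (\<lambda>x. ereal \<bar>g x\<bar>) < \<infinity>"
    and "ae_class M f = ae_class M g" by (auto simp: Linf_def)
  then have "AE x in M. f x = g x" using ae_class_eq_iff assms by blast
  with esssup_abs_bound[OF g] show "\<exists>C. AE x in M. \<bar>f x\<bar> \<le> C"
    by (intro exI) (auto elim!: eventually_elim2)
next
  assume "\<exists>C. AE x in M. \<bar>f x\<bar> \<le> C"
  then obtain C where C: "AE x in M. \<bar>f x\<bar> \<le> C" by blast
  have "AE x in M. \<bar>f x\<bar> \<le> max 0 C" using C by eventually_elim auto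
  from esssup_abs_leI(1)[OF assms this] show "ae_class M f \<in> vecs (Linf M)"
    by (auto simp: Linf_def)
qed

lemma real_normed_space_Linf: "real_normed_space (Linf M)"
proof -
  let ?N = "\<lambda>f. real_of_ereal (esssup M (\<lambda>x. ereal \<bar>f x :: real\<bar>))"
  have E: "\<exists>f. f \<in> borel_measurable M \<and> u = ae_class M f \<and> (AE x in M. \<bar>f x\<bar> \<le> ?N f)"
    if "u \<in> vecs (Linf M)" for u
    using that esssup_abs_bound by (auto simp: Linf_def)
  have N: "vnorm (Linf M) (ae_class M f) = ?N f" if "f \<in> borel_measurable M" for f
    using that by (simp add: Linf_def esssup_abs_rep)
  have A: "vadd (Linf M) (ae_class M f) (ae_class M g) = ae_class M (\<lambda>x. f x + g x)"
    if "f \<in> borel_measurable M" "g \<in> borel_measurable M" for f g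
    using that by (simp add: Linf_def ae_class_rep_add)
  have S: "vscale (Linf M) c (ae_class M f) = ae_class M (\<lambda>x. c * f x)"
    if "f \<in> borel_measurable M" for f c
    using that by (simp add: Linf_def ae_class_rep_scale)
  have Z: "vzero (Linf M) = ae_class M (\<lambda>x. 0)" by (simp add: Linf_def)
  have scale_le: "(AE x in M. \<bar>c * f x\<bar> \<le> \<bar>c\<bar> * ?N f)" if "AE x in M. \<bar>f x\<bar> \<le> ?N f" for c f
    using that by eventually_elim (simp add: abs_mult mult_left_mono)
  have add_le: "(AE x in M. \<bar>f x + g x\<bar> \<le> ?N f + ?N g)"
    if "AE x in M. \<bar>f x\<bar> \<le> ?N f" "AE x in M. \<bar>g x\<bar> \<le> ?N g" for f g
    using that by eventually_elim linarith
  have norm_scale_le: "?N (\<lambda>x. c * f x) \<le> \<bar>c\<bar> * ?N f"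
    if "f \<in> borel_measurable M" "AE x in M. \<bar>f x\<bar> \<le> ?N f" for c f
    using that by (intro esssup_abs_leI(2) scale_le) (auto simp: esssup_abs_nonneg)
  show ?thesis
  proof (standard, goal_cases)
    case (1 u v)
    then obtain f g where fg [measurable]: "f \<in> borel_measurable M" "g \<in> borel_measurable M"
      and *: "u = ae_class M f" "v = ae_class M g"
        "AE x in M. \<bar>f x\<bar> \<le> ?N f" "AE x in M. \<bar>g x\<bar> \<le> ?N g"
      using E by metis
    then show ?case using add_le by (subst *, subst *, subst A) (auto simp: Linf_vecs_iff)
  next
    case (2 u c)
    then obtain f where f [measurable]: "f \<in> borel_measurable M"
      and *: "u = ae_class M f" "AE x in M. \<bar>f x\<bar> \<le> ?N f"
      using E by metis
    have "ae_class M (\<lambda>x. c * f x) \<in> vecs (Linf M)"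
      by (subst Linf_vecs_iff) (use scale_le[OF *(2)] in auto)
    then show ?case by (simp add: * S)
  next
    case 3
    show ?case unfolding Z by (subst Linf_vecs_iff) auto
  next
    case (12 u)
    then obtain f where f [measurable]: "f \<in> borel_measurable M"
      and *: "u = ae_class M f" "AE x in M. \<bar>f x\<bar> \<le> ?N f"
      using E by metis
    show ?case
    proof
      assume "vnorm (Linf M) u = 0"
      then have "?N f = 0" by (simp only: * N f)
      with * show "u = vzero (Linf M)" by (simp add: Z ae_class_eq_iff)
    next
      assume "u = vzero (Linf M)"
      then have "AE x in M. \<bar>f x\<bar> \<le> 0" by (simp add: * Z ae_class_eq_iff)
      then have "?N f \<le> 0" by (intro esssup_abs_leI(2)) auto
      then have "?N f = 0" using esssup_abs_nonneg[of M f] by (rule antisym)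
      then show "vnorm (Linf M) u = 0" by (simp only: * N f)
    qed
  next
    case (13 u c)
    then obtain f where f [measurable]: "f \<in> borel_measurable M"
      and *: "u = ae_class M f" "AE x in M. \<bar>f x\<bar> \<le> ?N f"
      using E by metis
    have "\<bar>c\<bar> * ?N f \<le> ?N (\<lambda>x. c * f x)"
    proof (cases "c = 0")
      case True
      then show ?thesis using esssup_abs_nonneg[of M "\<lambda>x. 0"] by simp
    next
      case False
      have "AE x in M. \<bar>c * f x\<bar> \<le> ?N (\<lambda>x. c * f x)"
        by (rule esssup_abs_bound, simp)
          (rule esssup_abs_leI(1)[OF _ scale_le[OF *(2)]], auto simp: esssup_abs_nonneg)
      then have "?N (\<lambda>x. inverse c * (c * f x)) \<le> \<bar>inverse c\<bar> * ?N (\<lambda>x. c * f x)"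
        by (intro norm_scale_le) auto
      moreover have "(\<lambda>x. inverse c * (c * f x)) = f" using False by (auto simp: fun_eq_iff)
      ultimately show ?thesis using False by (simp add: field_simps)
    qed
    with norm_scale_le[OF f *(2), of c] show ?case by (simp add: * N S)
  next
    case (14 u v)
    then obtain f g where fg [measurable]: "f \<in> borel_measurable M" "g \<in> borel_measurable M"
      and *: "u = ae_class M f" "v = ae_class M g"
        "AE x in M. \<bar>f x\<bar> \<le> ?N f" "AE x in M. \<bar>g x\<bar> \<le> ?N g"
      using E by metis
    have "?N (\<lambda>x. f x + g x) \<le> ?N f + ?N g"
      using * by (intro esssup_abs_leI(2) add_le) (auto simp: esssup_abs_nonneg)
    then show ?case by (simp add: * A N)
  qed (auto dest!: E simp: A S Z algebra_simps)
qed

lemma op_norm_upper: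
  assumes "real_normed_space X" "bdd_lin_map X real_line p" "x \<in> vecs X"
  shows "bdd_above ((\<lambda>x. vnorm real_line (p x)) ` unit_ball X)"
    and "\<bar>p x\<bar> \<le> op_norm X real_line p * vnorm X x"
proof -
  interpret real_normed_space X by fact
  have sc: "\<And>c x. x \<in> vecs X \<Longrightarrow> p (vscale X c x) = c * p x"
    using assms(2) by (auto simp: bdd_lin_map_def lin_map_def real_line_def)
  have "\<exists>K. \<forall>x\<in>vecs X. \<bar>p x\<bar> \<le> K * vnorm X x"
    using assms(2) by (auto simp: bdd_lin_map_def real_line_def)
  then obtain K where K: "\<And>x. x \<in> vecs X \<Longrightarrow> \<bar>p x\<bar> \<le> K * vnorm X x" by blast
  have nn: "0 \<le> vnorm X x" if "x \<in> vecs X" for x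
    using norm_triangle[OF that scale_closed[OF that, of "-1"]] that
    by (simp add: add_inverse norm_scale zero_closed norm_zero_iff[THEN iffD2])
  show bdd: "bdd_above ((\<lambda>x. vnorm real_line (p x)) ` unit_ball X)"
  proof (rule bdd_aboveI2)
    fix x assume x: "x \<in> unit_ball X"
    then have "K * vnorm X x \<le> \<bar>K\<bar> * 1"
      using nn[of x] by (intro mult_mono) (auto simp: unit_ball_def)
    with K[of x] x show "vnorm real_line (p x) \<le> \<bar>K\<bar>"
      by (auto simp: unit_ball_def real_line_def)
  qed
  show "\<bar>p x\<bar> \<le> op_norm X real_line p * vnorm X x"
  proof (cases "vnorm X x = 0")
    case True
    with K[OF assms(3)] show ?thesis by simp
  next
    case False
    let ?c = "inverse (vnorm X x)"
    have "vscale X ?c x \<in> unit_ball X"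
      using False assms(3) nn[OF assms(3)] by (auto simp: unit_ball_def scale_closed norm_scale)
    from cSUP_upper[OF this bdd] show ?thesis
      using False assms(3) nn[OF assms(3)]
      by (simp add: op_norm_def real_line_def sc abs_mult field_simps)
  qed
qed

lemma op_norm_least:
  assumes "real_normed_space X" "\<And>x. x \<in> unit_ball X \<Longrightarrow> \<bar>p x\<bar> \<le> C"
  shows "op_norm X real_line p \<le> C"
proof -
  interpret real_normed_space X by fact
  have "vzero X \<in> unit_ball X"
    using norm_zero_iff[OF zero_closed] by (simp add: unit_ball_def zero_closed)
  then show ?thesis
    unfolding op_norm_def by (intro cSUP_least) (auto simp: real_line_def assms(2))
qed

lemma real_normed_space_dual:
  assumes "real_normed_space X"
  shows "real_normed_space (dual_space X)"
proof -
  interpret real_normed_space X by fact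
  let ?N = "op_norm X real_line"
  have zb: "vzero X \<in> unit_ball X"
    using norm_zero_iff[OF zero_closed] by (simp add: unit_ball_def zero_closed)
  have D: "p \<in> vecs (dual_space X) \<longleftrightarrow> p \<in> extensional (vecs X) \<and> bdd_lin_map X real_line p" for p
    by (simp add: dual_space_def)
  have B: "bdd_lin_map X real_line p \<longleftrightarrow>
      (\<forall>x\<in>vecs X. \<forall>y\<in>vecs X. p (vadd X x y) = p x + p y) \<and>
      (\<forall>c. \<forall>x\<in>vecs X. p (vscale X c x) = c * p x) \<and>
      (\<exists>K. \<forall>x\<in>vecs X. \<bar>p x\<bar> \<le> K * vnorm X x)" for p
    by (simp add: bdd_lin_map_def lin_map_def real_line_def)
  have U: "\<bar>p x\<bar> \<le> ?N p * vnorm X x" if "p \<in> vecs (dual_space X)" "x \<in> vecs X" for p x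
    using op_norm_upper(2)[OF assms] that D by blast
  have U1: "\<bar>p x\<bar> \<le> ?N p" if "p \<in> vecs (dual_space X)" "x \<in> unit_ball X" for p x
    using cSUP_upper[OF that(2) op_norm_upper(1)[OF assms _ zero_closed, of p]] that D
    by (simp add: op_norm_def real_line_def)
  have nn: "0 \<le> ?N p" if "p \<in> vecs (dual_space X)" for p
    using U1[OF that zb] by linarith
  have scale_le: "?N (\<lambda>x\<in>vecs X. c * p x) \<le> \<bar>c\<bar> * ?N p" if "p \<in> vecs (dual_space X)" for c p
    using U1[OF that]
    by (intro op_norm_least[OF assms]) (auto simp: unit_ball_def abs_mult mult_left_mono)
  have SC: "(\<lambda>x\<in>vecs X. c * p x) \<in> vecs (dual_space X)" if "p \<in> vecs (dual_space X)" for c p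
  proof -
    have "\<forall>x\<in>vecs X. \<bar>c * p x\<bar> \<le> (\<bar>c\<bar> * ?N p) * vnorm X x"
      using U[OF that] by (simp add: abs_mult mult.assoc mult_left_mono)
    then have "\<exists>K. \<forall>x\<in>vecs X. \<bar>(\<lambda>x\<in>vecs X. c * p x) x\<bar> \<le> K * vnorm X x"
      by (intro exI[of _ "\<bar>c\<bar> * ?N p"]) simp
    with that show ?thesis
      unfolding D B by (simp add: add_closed scale_closed algebra_simps)
  qed
  show ?thesis
  proof (standard, goal_cases)
    case (1 p q)
    have "\<forall>x\<in>vecs X. \<bar>p x + q x\<bar> \<le> (?N p + ?N q) * vnorm X x"
    proof
      fix x assume "x \<in> vecs X"
      with U[OF 1(1)] U[OF 1(2)] have "\<bar>p x\<bar> \<le> ?N p * vnorm X x" "\<bar>q x\<bar> \<le> ?N q * vnorm X x"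
        by blast+
      then show "\<bar>p x + q x\<bar> \<le> (?N p + ?N q) * vnorm X x" by (simp add: distrib_right)
    qed
    then have "\<exists>K. \<forall>x\<in>vecs X. \<bar>(\<lambda>x\<in>vecs X. p x + q x) x\<bar> \<le> K * vnorm X x"
      by (intro exI[of _ "?N p + ?N q"]) simp
    with 1 have "(\<lambda>x\<in>vecs X. p x + q x) \<in> vecs (dual_space X)"
      unfolding D B by (simp add: add_closed scale_closed algebra_simps)
    then show ?case by (simp add: dual_space_def)
  next
    case (2 p c)
    with SC[of p c] show ?case by (simp add: dual_space_def)
  next
    case 3
    have "(\<lambda>x\<in>vecs X. 0) \<in> vecs (dual_space X)"
      unfolding D B by (auto simp: add_closed scale_closed intro!: exI[of _ 0])
    then show ?case by (simp add: dual_space_def)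
  next
    case (12 p)
    show ?case
    proof
      assume "vnorm (dual_space X) p = 0"
      then have "p x = 0" if "x \<in> vecs X" for x
        using U[OF 12 that] by (simp add: dual_space_def)
      with 12 have "p = (\<lambda>x\<in>vecs X. 0)" unfolding D by (auto simp: extensional_def fun_eq_iff)
      then show "p = vzero (dual_space X)" by (simp add: dual_space_def)
    next
      assume "p = vzero (dual_space X)"
      then have "?N p \<le> 0"
        by (intro op_norm_least[OF assms]) (auto simp: dual_space_def unit_ball_def)
      with nn[OF 12] show "vnorm (dual_space X) p = 0" by (simp add: dual_space_def)
    qed
  next
    case (13 p c)
    have "\<bar>c\<bar> * ?N p \<le> ?N (\<lambda>x\<in>vecs X. c * p x)"
    proof (cases "c = 0")
      case True
      with nn[OF SC[OF 13, of 0]] show ?thesis by simp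
    next
      case False
      have "(\<lambda>x\<in>vecs X. inverse c * (\<lambda>x\<in>vecs X. c * p x) x) = p"
        using False 13 unfolding D by (auto simp: extensional_def fun_eq_iff)
      with scale_le[OF SC[OF 13, of c], of "inverse c"]
      have "?N p \<le> \<bar>inverse c\<bar> * ?N (\<lambda>x\<in>vecs X. c * p x)" by simp
      with False show ?thesis by (simp add: field_simps)
    qed
    with scale_le[OF 13, of c] show ?case by (simp add: dual_space_def)
  next
    case (14 p q)
    have "?N (\<lambda>x\<in>vecs X. p x + q x) \<le> ?N p + ?N q"
    proof (rule op_norm_least[OF assms])
      fix x assume "x \<in> unit_ball X"
      with U1[OF 14(1)] U1[OF 14(2)] show "\<bar>(\<lambda>x\<in>vecs X. p x + q x) x\<bar> \<le> ?N p + ?N q"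
        by (auto simp: unit_ball_def intro: order_trans[OF abs_triangle_ineq add_mono])
    qed
    then show ?case by (simp add: dual_space_def)
  qed (auto simp: dual_space_def fun_eq_iff algebra_simps extensional_def)
qed

end

theory Submission
  imports Defs
begin

text \<open>
  Localizability enters in two ways: functionals on L1 are exactly the integrations against bounded
  functions, with equal norms, and the measure is semifinite.

  Suppose that the measure is atomless. Then every set of positive measure contains sets of
  arbitrarily small positive measure, so any sequence of sets \<open>A n\<close> of positive measure, repetitions
  and overlaps allowed, can be shrunk to pairwise disjoint sets \<open>B n\<close> of finite positive measure
  (\<open>disjoint_refinement\<close>), on which signs can be prescribed independently by one function bounded by 1
  (\<open>disjoint_sign_pattern\<close>). All four main implications come from this.

  \<^item> Given countably many norm-one functionals on L1, let the sets \<open>A n\<close> be places where one of the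
    representing functions is within \<open>1 / (k + 1)\<close> of its norm, in absolute value and with constant
    sign. The normalized signed indicators of the sets \<open>B n\<close> norm the given functionals, and the
    common sign function takes the value 1 at each of them: this is the 1-ASD2P for countable sets.
    The SD2P and the absence of strongly exposed points follow from it in any normed space.

  \<^item> Given a separable subspace of Linf, use every element of a countable dense set and every
    precision twice, with both signs. The sign function is then a direction along which the norm
    adds up, so the \<open>(-1)\<close>-BCP fails. Finite-dimensional subspaces are separable, whence octahedrality.

  \<^item> For the Daugavet property of either space it suffices to find, in a given slice, an element \<open>x\<close>
    such that \<open>\<parallel>x + u\<parallel>\<close> is almost \<open>1 + \<parallel>u\<parallel>\<close> (\<open>DaugavetI\<close>). In L1 a normalized indicator works whose
    support carries almost nothing of \<open>u\<close>; in Linf one takes any element of the slice and overwrites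
    it, by the sign of \<open>u\<close>, on a set where \<open>\<bar>u\<bar>\<close> is almost \<open>\<parallel>u\<parallel>\<close>. Among many disjoint
    sets of this kind there is one for which the changed element is still in the slice.

  Suppose that \<open>A\<close> is an atom. Functions are almost everywhere constant on \<open>A\<close>, hence \<open>A\<close> splits off a
  line from both spaces: L1 is the l1-sum of that line and the rest, Linf the max-sum. The
  first makes the normalized indicator of \<open>A\<close> a strongly exposed point with linear modulus
  (\<open>sharply_exposed_if_atom\<close>), which excludes the SD2P, hence also the 1-ASD2P, and the Daugavet
  property. The second (\<open>line_max_summand_if_atom\<close>) excludes octahedrality, the failure of the
  \<open>(-1)\<close>-BCP and the Daugavet property of Linf.
\<close>

section \<open>Vector arithmetic and duality in a normed space\<close>

context real_normed_space
begin

lemmas [simp] = add_closed scale_closed zero_closed add_zero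

lemma norm_zero [simp]: "vnorm X (vzero X) = 0"
  using norm_zero_iff[OF zero_closed] by simp

lemma scale_zero_left [simp]: "x \<in> vecs X \<Longrightarrow> vscale X 0 x = vzero X"
  using norm_zero_iff[of "vscale X 0 x"] by (simp add: norm_scale)

lemma scale_zero_right [simp]: "vscale X c (vzero X) = vzero X"
  using norm_zero_iff[of "vscale X c (vzero X)"] by (simp add: norm_scale)

lemma norm_nonneg: "x \<in> vecs X \<Longrightarrow> 0 \<le> vnorm X x"
  using norm_triangle[of x "vscale X (-1) x"] by (simp add: add_inverse norm_scale)

lemma zero_add [simp]: "x \<in> vecs X \<Longrightarrow> vadd X (vzero X) x = x"
  using add_commute[of "vzero X" x] by (simp add: add_zero)

lemma add_left_commute:
  "\<lbrakk>x \<in> vecs X; y \<in> vecs X; z \<in> vecs X\<rbrakk> \<Longrightarrow> vadd X x (vadd X y z) = vadd X y (vadd X x z)"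
  by (metis add_assoc add_commute)

lemma sub_closed [simp]: "\<lbrakk>x \<in> vecs X; y \<in> vecs X\<rbrakk> \<Longrightarrow> vsub X x y \<in> vecs X"
  by (simp add: vsub_def)

lemma norm_sub_commute:
  assumes "x \<in> vecs X" "y \<in> vecs X"
  shows "vnorm X (vsub X x y) = vnorm X (vsub X y x)"
proof -
  have "vsub X y x = vscale X (-1) (vsub X x y)"
    using assms by (simp add: vsub_def scale_add scale_scale scale_one add_commute)
  then show ?thesis using assms by (simp add: norm_scale)
qed

lemma norm_sub_triangle:
  assumes "x \<in> vecs X" "y \<in> vecs X" "z \<in> vecs X"
  shows "vnorm X (vsub X x z) \<le> vnorm X (vsub X x y) + vnorm X (vsub X y z)"
proof -
  have "vadd X (vsub X x y) (vsub X y z)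
      = vadd X x (vadd X (vadd X y (vscale X (-1) y)) (vscale X (-1) z))"
    using assms by (simp add: vsub_def add_assoc add_left_commute)
  also have "\<dots> = vsub X x z"
    using assms by (simp add: add_inverse add_zero vsub_def)
  finally show ?thesis using norm_triangle[of "vsub X x y" "vsub X y z"] assms by simp
qed

text \<open>
  Lipschitz dependence of a translate's norm on the base point; used to pass from a dense set of
  base points to all of them.
\<close>

lemma norm_add_perturb:
  assumes "x \<in> vecs X" "y \<in> vecs X" "z \<in> vecs X"
  shows "vnorm X (vadd X x z) \<le> vnorm X (vadd X y z) + vnorm X (vsub X y x)"
proof -
  have "vadd X (vadd X y z) (vsub X x y) = vadd X (vadd X x z) (vadd X y (vscale X (-1) y))"
    using assms by (simp add: vsub_def add_assoc add_left_commute add_commute)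
  also have "\<dots> = vadd X x z" using assms by (simp add: add_inverse)
  finally show ?thesis
    using norm_triangle[of "vadd X y z" "vsub X x y"] norm_sub_commute[of x y] assms by simp
qed

lemma zero_in_ball: "vzero X \<in> unit_ball X"
  by (simp add: unit_ball_def)

lemma uminus_in_ball: "x \<in> unit_ball X \<Longrightarrow> vscale X (-1) x \<in> unit_ball X"
  by (simp add: unit_ball_def norm_scale)

lemma ball_vecs: "x \<in> unit_ball X \<Longrightarrow> x \<in> vecs X"
  by (simp add: unit_ball_def)

lemma norm_scaled_ball_le: "\<lbrakk>x \<in> unit_ball X; 0 \<le> r\<rbrakk> \<Longrightarrow> vnorm X (vscale X r x) \<le> r"
  using mult_left_mono[of "vnorm X x" 1 r] by (simp add: unit_ball_def norm_scale)

lemma op_norm_leI: "(\<And>x. x \<in> unit_ball X \<Longrightarrow> vnorm Y (T x) \<le> C) \<Longrightarrow> op_norm X Y T \<le> C"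
  unfolding op_norm_def using zero_in_ball by (intro cSUP_least) auto

lemma op_norm_geI:
  assumes "x \<in> unit_ball X" "\<And>y. y \<in> unit_ball X \<Longrightarrow> vnorm Y (T y) \<le> C"
  shows "vnorm Y (T x) \<le> op_norm X Y T"
  unfolding op_norm_def using assms by (intro cSUP_upper bdd_aboveI2)

lemma dual_iff: "p \<in> vecs (dual_space X) \<longleftrightarrow> p \<in> extensional (vecs X) \<and>
      (\<forall>x\<in>vecs X. \<forall>y\<in>vecs X. p (vadd X x y) = p x + p y) \<and>
      (\<forall>c. \<forall>x\<in>vecs X. p (vscale X c x) = c * p x) \<and>
      (\<exists>K. \<forall>x\<in>vecs X. \<bar>p x\<bar> \<le> K * vnorm X x)"
  by (simp add: dual_space_def bdd_lin_map_def lin_map_def real_line_def)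

lemma
  assumes "p \<in> vecs (dual_space X)"
  shows dual_add: "\<lbrakk>x \<in> vecs X; y \<in> vecs X\<rbrakk> \<Longrightarrow> p (vadd X x y) = p x + p y"
    and dual_scale: "x \<in> vecs X \<Longrightarrow> p (vscale X c x) = c * p x"
    and dual_sub: "\<lbrakk>x \<in> vecs X; y \<in> vecs X\<rbrakk> \<Longrightarrow> p (vsub X x y) = p x - p y"
  using assms by (auto simp: dual_iff vsub_def)

lemma dual_bound:
  assumes "p \<in> vecs (dual_space X)" "x \<in> vecs X"
  shows "\<bar>p x\<bar> \<le> vnorm (dual_space X) p * vnorm X x"
  using op_norm_upper(2)[OF real_normed_space_axioms _ assms(2), of p] assms(1)
  by (simp add: dual_space_def)

lemma dual_norm_leI:
  "(\<And>x. x \<in> unit_ball X \<Longrightarrow> \<bar>p x\<bar> \<le> C) \<Longrightarrow> vnorm (dual_space X) p \<le> C"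
  using op_norm_least[OF real_normed_space_axioms] by (simp add: dual_space_def)

lemma dual_sphere_bound:
  assumes "p \<in> unit_sphere (dual_space X)" "x \<in> vecs X"
  shows "\<bar>p x\<bar> \<le> vnorm X x"
  using dual_bound[of p x] assms by (simp add: unit_sphere_def)

lemma dual_norm_nonneg: "p \<in> vecs (dual_space X) \<Longrightarrow> 0 \<le> vnorm (dual_space X) p"
  using real_normed_space.norm_nonneg[OF real_normed_space_dual[OF real_normed_space_axioms]] .

lemma dual_norm_scale:
  assumes "p \<in> vecs (dual_space X)"
  shows "(\<lambda>x\<in>vecs X. c * p x) \<in> vecs (dual_space X)"
    and "vnorm (dual_space X) (\<lambda>x\<in>vecs X. c * p x) = \<bar>c\<bar> * vnorm (dual_space X) p"
proof -
  interpret D: real_normed_space "dual_space X"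
    by (rule real_normed_space_dual[OF real_normed_space_axioms])
  have "(\<lambda>x\<in>vecs X. c * p x) = vscale (dual_space X) c p" by (simp add: dual_space_def)
  then show "(\<lambda>x\<in>vecs X. c * p x) \<in> vecs (dual_space X)"
    "vnorm (dual_space X) (\<lambda>x\<in>vecs X. c * p x) = \<bar>c\<bar> * vnorm (dual_space X) p"
    using D.scale_closed[OF assms] D.norm_scale[OF assms] by simp_all
qed

lemma dual_norm_attained_nearly:
  assumes "p \<in> vecs (dual_space X)" "C < vnorm (dual_space X) p"
  shows "\<exists>x\<in>unit_ball X. C < p x"
proof (rule ccontr)
  assume "\<not> ?thesis"
  then have *: "p x \<le> C" if "x \<in> unit_ball X" for x using that by force
  have "\<bar>p x\<bar> \<le> C" if "x \<in> unit_ball X" for x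
    using *[OF that] *[OF uminus_in_ball[OF that]] dual_scale[OF assms(1) ball_vecs[OF that], of "-1"]
    by simp
  from dual_norm_leI[of p C, OF this] assms(2) show False by simp
qed

section \<open>Consequences of the 1-ASD2P for countable sets\<close>

lemma lin_comb_vecs: "\<forall>i<n. x i \<in> vecs X \<Longrightarrow> lin_comb X c x n \<in> vecs X"
  by (induction n) auto

lemma dual_lin_comb:
  assumes "p \<in> vecs (dual_space X)"
  shows "\<forall>i<n. x i \<in> vecs X \<Longrightarrow> p (lin_comb X c x n) = (\<Sum>i<n. c i * p (x i))"
proof (induction n)
  case 0
  show ?case using dual_scale[OF assms zero_closed, of 0] by simp
next
  case (Suc n)
  then show ?case by (simp add: dual_add[OF assms] dual_scale[OF assms] lin_comb_vecs)
qed

lemma norm_lin_comb_le: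
  "\<forall>i<n. x i \<in> vecs X \<Longrightarrow> vnorm X (lin_comb X c x n) \<le> (\<Sum>i<n. \<bar>c i\<bar> * vnorm X (x i))"
proof (induction n)
  case (Suc n)
  then show ?case
    using norm_triangle[of "lin_comb X c x n" "vscale X (c n) (x n)"]
    by (simp add: norm_scale lin_comb_vecs)
qed simp

lemma norms_functionalsE:
  assumes "norms_functionals X B A" "p \<in> A" "A \<subseteq> unit_sphere (dual_space X)"
    "B \<subseteq> unit_sphere X" "0 < r" "r < 1"
  obtains x where "x \<in> B" "p x \<ge> r"
proof -
  obtain x where x: "x \<in> B" "p x \<ge> r * vnorm (dual_space X) p * vnorm X x"
    using assms(1,2,5,6) unfolding norms_functionals_def by blast
  moreover have "vnorm (dual_space X) p = 1" "vnorm X x = 1"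
    using assms(2,3,4) x(1) by (auto simp: unit_sphere_def)
  ultimately show ?thesis using that by simp
qed

text \<open>
  The functionals defining the slices are normed by unit vectors at which a single norm-one
  functional takes the value 1. That functional is also 1 at every convex combination of such
  vectors, so the combination has norm 1.
\<close>

lemma SD2P_if_one_ASD2P_omega:
  assumes "one_ASD2P_omega X"
  shows "SD2P X"
  unfolding SD2P_def
proof (intro allI impI, elim conjE)
  fix n :: nat and c :: "nat \<Rightarrow> real" and S and r :: real
  assume cS: "\<forall>i<n. 0 \<le> c i \<and> S i \<in> slices X" and sum: "(\<Sum>i<n. c i) = 1" and r: "0 < r" "r < 1"
  have "\<forall>i. \<exists>p e. i < n \<longrightarrow> p \<in> unit_sphere (dual_space X) \<and> 0 < e \<and> e < 1 \<and>
      S i = {x \<in> unit_ball X. p x \<ge> 1 - e}"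
    using cS unfolding slices_def by blast
  then obtain p e where pe: "\<And>i. i < n \<Longrightarrow> p i \<in> unit_sphere (dual_space X) \<and> 0 < e i \<and> e i < 1 \<and>
      S i = {x \<in> unit_ball X. p i x \<ge> 1 - e i}"
    by metis
  let ?A = "p ` {..<n}"
  have A: "countable ?A" "?A \<subseteq> unit_sphere (dual_space X)"
    using pe by (auto intro: countable_finite[OF finite_imageI])
  then obtain B q where B: "B \<subseteq> unit_sphere X" and q: "q \<in> unit_sphere (dual_space X)"
    and norms: "norms_functionals X B ?A" and qB: "\<forall>x\<in>B. q x = 1"
    using assms unfolding one_ASD2P_omega_def by metis
  have "\<exists>x. x \<in> B \<and> p i x \<ge> 1 - e i" if "i < n" for i
    by (rule norms_functionalsE[OF norms _ A(2) B, of "p i" "1 - e i"]) (use pe[OF that] that in auto)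
  then obtain x where x: "\<And>i. i < n \<Longrightarrow> x i \<in> B \<and> p i (x i) \<ge> 1 - e i" by metis
  have xv: "x i \<in> vecs X" "vnorm X (x i) = 1" if "i < n" for i
    using x[OF that] B by (auto simp: unit_sphere_def)
  have xS: "x i \<in> S i" if "i < n" for i
    using x[OF that] xv[OF that] pe[OF that] by (simp add: unit_ball_def)
  let ?u = "lin_comb X c x n"
  have u: "?u \<in> vecs X" using xv by (intro lin_comb_vecs) auto
  have "vnorm X ?u \<le> (\<Sum>i<n. \<bar>c i\<bar> * vnorm X (x i))"
    using xv by (intro norm_lin_comb_le) auto
  also have "\<dots> = (\<Sum>i<n. c i)" using cS xv by (intro sum.cong) auto
  finally have "?u \<in> unit_ball X" using u sum by (simp add: unit_ball_def)
  moreover have "q ?u = 1"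
    using q qB x xv sum by (subst dual_lin_comb) (auto simp: unit_sphere_def)
  then have "1 \<le> vnorm X ?u" using dual_sphere_bound[OF q u] by simp
  then have "?u \<notin> vscale X r ` unit_ball X"
    using norm_scaled_ball_le[of _ r] r by fastforce
  moreover have "?u \<in> {lin_comb X c x n |x. \<forall>i<n. x i \<in> S i}"
    using xS by (intro CollectI exI[of _ x]) simp
  ultimately have "?u \<in> {lin_comb X c x n |x. \<forall>i<n. x i \<in> S i}
      \<inter> (unit_ball X - vscale X r ` unit_ball X)"
    by (intro IntI DiffI)
  then show "{lin_comb X c x n |x. \<forall>i<n. x i \<in> S i}
      \<inter> (unit_ball X - vscale X r ` unit_ball X) \<noteq> {}"
    by (rule_tac notI) (simp only: empty_iff)
qed

text \<open>
  Suppose that \<open>p\<close> strongly exposes \<open>x\<close>. Unit vectors that almost norm \<open>p\<close> are close to \<open>x\<close>, and those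
  that almost norm \<open>- p\<close> are close to \<open>- x\<close>, so a vector of the first kind and one of the second almost
  cancel. This is impossible if one norm-one functional takes the value 1 at both.
\<close>

lemma no_strongly_exposed_if_one_ASD2P_omega:
  assumes "one_ASD2P_omega X"
  shows "\<not> strongly_exposed_point X (unit_ball X) x"
proof
  assume "strongly_exposed_point X (unit_ball X) x"
  then obtain p where x: "x \<in> unit_ball X" and p: "p \<in> vecs (dual_space X)"
    and exposed: "\<And>y. \<lbrakk>y \<in> unit_ball X; y \<noteq> x\<rbrakk> \<Longrightarrow> p y < p x"
    and strong: "\<And>s. \<lbrakk>\<And>n. s n \<in> unit_ball X; (\<lambda>n::nat. p (s n)) \<longlonglongrightarrow> p x\<rbrakk>
      \<Longrightarrow> (\<lambda>n. vnorm X (vsub X (s n) x)) \<longlonglongrightarrow> 0"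
    unfolding strongly_exposed_point_def by blast
  let ?N = "vnorm (dual_space X) p"
  have px: "p x = ?N"
  proof (rule antisym)
    show "p x \<le> ?N"
      using dual_bound[OF p ball_vecs[OF x]] mult_left_mono[OF _ dual_norm_nonneg[OF p], of "vnorm X x" 1] x
      by (simp add: unit_ball_def)
    show "?N \<le> p x"
      using dual_norm_attained_nearly[OF p, of "p x"] exposed by (metis not_le less_asym)
  qed
  have "?N \<noteq> 0"
  proof
    assume N: "?N = 0"
    have "p y = 0" if "y \<in> vecs X" for y using dual_bound[OF p that] N by simp
    then have single: "y = z" if "y \<in> unit_ball X" "z \<in> unit_ball X" for y z
      using exposed that x ball_vecs by (metis less_irrefl)
    obtain q where q: "q \<in> unit_sphere (dual_space X)"
      using assms unfolding one_ASD2P_omega_def by (metis countable_empty empty_subsetI)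
    then obtain y where "y \<in> unit_ball X" "0 < q y"
      using dual_norm_attained_nearly[of q 0] by (auto simp: unit_sphere_def)
    moreover have "q (vzero X) = 0"
      using dual_scale[of q "vzero X" 0] q by (simp add: unit_sphere_def)
    ultimately show False using single zero_in_ball by fastforce
  qed
  then have N: "?N > 0" using dual_norm_nonneg[OF p] by simp
  define P where "P c = (\<lambda>y\<in>vecs X. (c / ?N) * p y)" for c :: real
  have PS: "P c \<in> unit_sphere (dual_space X)" if "\<bar>c\<bar> = 1" for c
    using dual_norm_scale[OF p, of "c / ?N"] that N by (simp add: P_def unit_sphere_def)
  have A: "countable {P 1, P (-1)}" "{P 1, P (-1)} \<subseteq> unit_sphere (dual_space X)"
    using PS by auto
  then obtain B q where B: "B \<subseteq> unit_sphere X" and q: "q \<in> unit_sphere (dual_space X)"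
    and norms: "norms_functionals X B {P 1, P (-1)}" and qB: "\<forall>x\<in>B. q x = 1"
    using assms unfolding one_ASD2P_omega_def by meson
  define r where "r n = 1 - inverse (real (Suc (Suc n)))" for n
  have r: "0 < r n" "r n < 1" for n by (simp_all add: r_def field_simps)
  have "(\<lambda>n. inverse (real (Suc (Suc n)))) \<longlonglongrightarrow> 0"
    using LIMSEQ_inverse_real_of_nat LIMSEQ_Suc by fast
  then have "(\<lambda>n. 1 - inverse (real (Suc (Suc n)))) \<longlonglongrightarrow> 1 - 0" by (intro tendsto_diff tendsto_const)
  then have rlim: "r \<longlonglongrightarrow> 1" unfolding r_def by simp
  have "\<forall>n. \<exists>y z. y \<in> B \<and> z \<in> B \<and> P 1 y \<ge> r n \<and> P (-1) z \<ge> r n"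
    using norms_functionalsE[OF norms _ A(2) B _ r(2)] r(1) by (metis insertCI)
  then obtain y z where yz: "\<And>n. y n \<in> B" "\<And>n. z n \<in> B" "\<And>n. P 1 (y n) \<ge> r n" "\<And>n. P (-1) (z n) \<ge> r n"
    by metis
  have v: "y n \<in> vecs X" "z n \<in> vecs X" "vnorm X (y n) = 1" "vnorm X (z n) = 1" for n
    using yz(1,2)[of n] B by (auto simp: unit_sphere_def)
  define w where "w n = vscale X (-1) (z n)" for n
  have w: "w n \<in> vecs X" "vnorm X (w n) = 1" for n using v by (simp_all add: w_def norm_scale)
  have near: "(\<lambda>n. vnorm X (vsub X (s n) x)) \<longlonglongrightarrow> 0"
    if s: "\<And>n. s n \<in> vecs X" "\<And>n. vnorm X (s n) = 1" "\<And>n. p (s n) \<ge> r n * ?N" for s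
  proof (rule strong)
    show "s n \<in> unit_ball X" for n using s by (simp add: unit_ball_def)
    have "(\<lambda>n. r n * ?N) \<longlonglongrightarrow> ?N" using tendsto_mult_right[OF rlim, of ?N] by simp
    moreover have "p (s n) \<le> ?N" for n using dual_bound[OF p s(1)[of n]] s(2)[of n] by (simp add: abs_le_iff)
    ultimately show "(\<lambda>n. p (s n)) \<longlonglongrightarrow> p x"
      unfolding px using s(3)
      by (rule_tac real_tendsto_sandwich[of "\<lambda>n. r n * ?N" _ _ "\<lambda>_. ?N"]) simp_all
  qed
  have "(\<lambda>n. vnorm X (vsub X (y n) x)) \<longlonglongrightarrow> 0"
    using yz(3) v N by (intro near) (auto simp: P_def field_simps)
  moreover have "(\<lambda>n. vnorm X (vsub X (w n) x)) \<longlonglongrightarrow> 0"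
    using yz(4) v w N by (intro near) (auto simp: P_def w_def dual_scale[OF p] field_simps)
  ultimately have lim: "(\<lambda>n. vnorm X (vsub X (y n) x) + vnorm X (vsub X (w n) x)) \<longlonglongrightarrow> 0"
    using tendsto_add[of _ 0 sequentially _ 0] by simp
  have "2 \<le> vnorm X (vsub X (y n) x) + vnorm X (vsub X (w n) x)" for n
  proof -
    have qv: "q \<in> vecs (dual_space X)" using q by (simp add: unit_sphere_def)
    have "q (vsub X (y n) (w n)) = 2"
      using yz(1,2)[of n] qB v by (simp add: dual_sub[OF qv] w_def dual_scale[OF qv])
    then have "2 \<le> vnorm X (vsub X (y n) (w n))"
      using dual_sphere_bound[OF q, of "vsub X (y n) (w n)"] v w by simp
    also have "\<dots> \<le> vnorm X (vsub X (y n) x) + vnorm X (vsub X x (w n))"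
      using v w x ball_vecs by (intro norm_sub_triangle) auto
    also have "vnorm X (vsub X x (w n)) = vnorm X (vsub X (w n) x)"
      using w x ball_vecs by (intro norm_sub_commute) auto
    finally show ?thesis .
  qed
  from LIMSEQ_le_const[OF lim, of 2] this show False by auto
qed


section \<open>Sharply exposed points\<close>

text \<open>
  A quantitative form of strong exposure: the distance to \<open>x\<close> is controlled linearly by the defect of
  \<open>p\<close>. The constant 2 is what an l1-summand of dimension one gives: if \<open>y\<close> has coordinate \<open>t\<close> on
  the line, then \<open>y\<close> differs from \<open>x\<close> by \<open>1 - t\<close> there and by at most \<open>1 - \<bar>t\<bar>\<close> elsewhere.
\<close>

definition sharply_exposed :: "('v \<Rightarrow> real) \<Rightarrow> 'v \<Rightarrow> bool" where
  "sharply_exposed p x \<longleftrightarrow> p \<in> unit_sphere (dual_space X) \<and> x \<in> unit_ball X \<and> p x = 1 \<and>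
     (\<forall>y\<in>unit_ball X. vnorm X (vsub X y x) \<le> 2 * (1 - p y))"

lemma
  assumes "sharply_exposed p x"
  shows sharply_exposed_dual: "p \<in> unit_sphere (dual_space X)" "p \<in> vecs (dual_space X)"
    and sharply_exposed_ball: "x \<in> unit_ball X" "x \<in> vecs X"
    and sharply_exposed_norm: "vnorm X x = 1"
    and sharply_exposed_value: "p x = 1"
    and sharply_exposed_near: "y \<in> unit_ball X \<Longrightarrow> vnorm X (vsub X y x) \<le> 2 * (1 - p y)"
  using assms dual_sphere_bound[of p x] unfolding sharply_exposed_def
  by (auto simp: unit_sphere_def unit_ball_def)

lemma strongly_exposed_if_sharply_exposed:
  assumes "sharply_exposed p x"
  shows "strongly_exposed_point X (unit_ball X) x"
  unfolding strongly_exposed_point_def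
proof (intro conjI bexI[of _ p] ballI impI allI)
  note S = sharply_exposed_dual[OF assms] sharply_exposed_ball[OF assms]
    sharply_exposed_value[OF assms] sharply_exposed_near[OF assms]
  show "x \<in> unit_ball X" "p \<in> vecs (dual_space X)" by (fact S)+
  fix y assume y: "y \<in> unit_ball X" "y \<noteq> x"
  show "p y < p x"
  proof (rule ccontr)
    assume "\<not> p y < p x"
    then have "vnorm X (vsub X y x) \<le> 0" using S(6)[OF y(1)] S(5) by simp
    then have "vnorm X (vsub X y x) = 0"
      using norm_nonneg[of "vsub X y x"] y S ball_vecs by force
    then have zero: "vsub X y x = vzero X" using norm_zero_iff y S ball_vecs by simp
    have "y = vadd X (vsub X y x) x"
      using y S ball_vecs add_inverse[of x] add_commute[of x "vscale X (-1) x"]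
      by (simp add: vsub_def add_assoc add_zero)
    also have "\<dots> = x" unfolding zero using S by simp
    finally show False using y by simp
  qed
next
  note S = sharply_exposed_value[OF assms] sharply_exposed_near[OF assms] sharply_exposed_ball[OF assms]
  fix s assume s: "(\<forall>n. s n \<in> unit_ball X) \<and> (\<lambda>n. p (s n)) \<longlonglongrightarrow> p x"
  then have "(\<lambda>n. 2 * (1 - p (s n))) \<longlonglongrightarrow> 2 * (1 - p x)"
    by (intro tendsto_intros) simp
  then have "(\<lambda>n. 2 * (1 - p (s n))) \<longlonglongrightarrow> 0" using S by simp
  moreover have "0 \<le> vnorm X (vsub X (s n) x)" for n
    using s S ball_vecs by (intro norm_nonneg sub_closed) auto
  moreover have "vnorm X (vsub X (s n) x) \<le> 2 * (1 - p (s n))" for n using s S by blast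
  ultimately show "(\<lambda>n. vnorm X (vsub X (s n) x)) \<longlonglongrightarrow> 0"
    by (rule_tac real_tendsto_sandwich[of "\<lambda>_. 0" _ _ "\<lambda>n. 2 * (1 - p (s n))"]) simp_all
qed

text \<open>
  The slice of \<open>p\<close> is concentrated near \<open>x\<close> and that of \<open>- p\<close> near \<open>- x\<close>, so the midpoints of the two
  slices have small norm.
\<close>

lemma not_SD2P_if_sharply_exposed:
  assumes "sharply_exposed p x"
  shows "\<not> SD2P X"
proof
  assume sd: "SD2P X"
  note S = sharply_exposed_dual[OF assms] sharply_exposed_ball[OF assms]
    sharply_exposed_value[OF assms] sharply_exposed_near[OF assms]
  define q where "q = (\<lambda>y\<in>vecs X. (-1) * p y)"
  have q: "q \<in> unit_sphere (dual_space X)"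
    using dual_norm_scale[OF S(2), of "-1"] S(1) by (simp add: q_def unit_sphere_def)
  \<comment> \<open>Vectors in these slices are within 1/2 of \<open>x\<close> and \<open>- x\<close>, so their midpoints have norm at most 1/2.\<close>
  define H where "H i = {y \<in> unit_ball X. (if i = 0 then p else q) y \<ge> 1 - 1/4}" for i :: nat
  have slice: "H i \<in> slices X" for i
    unfolding slices_def H_def using S(1) q
    by (intro CollectI exI[of _ "if i = 0 then p else q"] exI[of _ "1/4"]) auto
  have "{lin_comb X (\<lambda>_. 1/2) y 2 | y. \<forall>i<2. y i \<in> H i}
      \<inter> (unit_ball X - vscale X (1/2) ` unit_ball X) \<noteq> {}"
    using sd[unfolded SD2P_def, rule_format, of 2 "\<lambda>_. 1/2" H "1/2"] slice by simp
  then obtain y where y: "\<forall>i<2. y i \<in> H i"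
    and out: "lin_comb X (\<lambda>_. 1/2) y 2 \<notin> vscale X (1/2) ` unit_ball X" by blast
  have "y 0 \<in> H 0" "y 1 \<in> H 1" using y by simp_all
  then have H: "y 0 \<in> unit_ball X" "p (y 0) \<ge> 3/4" "y 1 \<in> unit_ball X" "q (y 1) \<ge> 3/4"
    by (simp_all add: H_def)
  note v = ball_vecs[OF H(1)] ball_vecs[OF H(3)]
  let ?w = "vscale X (-1) (y 1)"
  have w: "?w \<in> unit_ball X" "?w \<in> vecs X" using uminus_in_ball[OF H(3)] v by simp_all
  have "p ?w \<ge> 3/4" using H(4) v by (simp add: dual_scale[OF S(2)] q_def)
  then have near: "vnorm X (vsub X (y 0) x) \<le> 1/2" "vnorm X (vsub X ?w x) \<le> 1/2"
    using order_trans[OF S(6)[OF H(1)], of "1/2"] order_trans[OF S(6)[OF w(1)], of "1/2"] H(2) by simp_all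
  have "vadd X (y 0) (y 1) = vsub X (y 0) ?w"
    using v by (simp add: vsub_def scale_scale scale_one)
  moreover have "vnorm X (vsub X (y 0) ?w) \<le> 1"
    using norm_sub_triangle[OF v(1) S(4) w(2)] near norm_sub_commute[OF S(4) w(2)] by simp
  ultimately have sum: "vadd X (y 0) (y 1) \<in> unit_ball X" using v by (simp add: unit_ball_def)
  have "lin_comb X (\<lambda>_. 1/2) y 2 = vscale X (1/2) (vadd X (y 0) (y 1))"
    using v by (simp add: numeral_2_eq_2 add_zero scale_add)
  with sum out show False by blast
qed

lemma rank_one_operator:
  assumes "p \<in> vecs (dual_space X)" "v \<in> vecs X" "v \<noteq> vzero X" "w \<in> vecs X" "p w \<noteq> 0"
  shows "bdd_lin_map X X (\<lambda>y. vscale X (p y) v)" "rank_one X X (\<lambda>y. vscale X (p y) v)"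
proof -
  have "vnorm X (vscale X (p y) v) \<le> (vnorm (dual_space X) p * vnorm X v) * vnorm X y"
    if "y \<in> vecs X" for y
    using mult_right_mono[OF dual_bound[OF assms(1) that] norm_nonneg[OF assms(2)]] assms(2) that
    by (simp add: norm_scale mult_ac)
  then show "bdd_lin_map X X (\<lambda>y. vscale X (p y) v)"
    using assms unfolding bdd_lin_map_def lin_map_def
    by (auto simp: dual_add[OF assms(1)] dual_scale[OF assms(1)] add_scale scale_scale)
  have "vscale X c v \<in> (\<lambda>y. vscale X (p y) v) ` vecs X" for c
    using assms by (intro image_eqI[of _ _ "vscale X (c / p w) w"]) (auto simp: dual_scale[OF assms(1)])
  then show "rank_one X X (\<lambda>y. vscale X (p y) v)"
    using assms unfolding rank_one_def by (intro bexI[of _ v]) auto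
qed

text \<open>
  The operator subtracting \<open>p y\<close> times \<open>x\<close> from \<open>y\<close> should have norm 2 by the Daugavet equation. But
  if \<open>t = p y\<close> is near 1 then \<open>y\<close> is near \<open>x\<close> and the image is small, while if \<open>t\<close> is far from
  1 the image has norm at most \<open>1 + t\<close>.
\<close>

lemma not_Daugavet_if_sharply_exposed:
  assumes "sharply_exposed p x"
  shows "\<not> Daugavet X"
proof
  assume D: "Daugavet X"
  note S = sharply_exposed_dual[OF assms] sharply_exposed_ball[OF assms]
    sharply_exposed_value[OF assms] sharply_exposed_near[OF assms] sharply_exposed_norm[OF assms]
  let ?v = "vscale X (-1) x"
  let ?T = "\<lambda>y. vscale X (p y) ?v"
  have v: "?v \<in> vecs X" "vnorm X ?v = 1" using S by (simp_all add: norm_scale)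
  then have "?v \<noteq> vzero X" by auto
  from rank_one_operator[OF S(2) v(1) this S(4)] S(5) D
  have "op_norm X X (\<lambda>y. vadd X y (?T y)) = 1 + op_norm X X ?T"
    unfolding Daugavet_def by simp
  moreover have "1 \<le> op_norm X X ?T"
  proof -
    have "vnorm X (?T x) \<le> op_norm X X ?T"
      using S(1) v dual_sphere_bound[OF S(1)]
      by (intro op_norm_geI[OF S(3), of _ _ 1]) (force simp: unit_ball_def norm_scale)
    then show ?thesis using S v by (simp add: norm_scale)
  qed
  moreover have "op_norm X X (\<lambda>y. vadd X y (?T y)) \<le> 3/2"
  proof (rule op_norm_leI)
    \<comment> \<open>The two bounds \<open>3 * (1 - p y)\<close> and \<open>1 + p y\<close> cross at \<open>p y = 1 / 2\<close>.\<close>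
    have *: "vnorm X (vadd X y (?T y)) \<le> 3/2" if y: "y \<in> unit_ball X" "p y \<ge> 0" for y
    proof -
      note yv = ball_vecs[OF y(1)]
      have T: "vadd X y (?T y) = vsub X y (vscale X (p y) x)"
        using S by (simp add: vsub_def scale_scale mult.commute)
      have py: "p y \<le> 1" using dual_sphere_bound[OF S(1) yv] y by (simp add: unit_ball_def)
      have "vnorm X (vsub X y (vscale X (p y) x))
          \<le> vnorm X (vsub X y x) + vnorm X (vsub X x (vscale X (p y) x))"
        using S yv by (intro norm_sub_triangle) auto
      also have "vsub X x (vscale X (p y) x) = vscale X (1 - p y) x"
        using S add_scale[of x 1 "- p y"] by (simp add: vsub_def scale_scale scale_one)
      also have "vnorm X (vscale X (1 - p y) x) = 1 - p y" using S py by (simp add: norm_scale)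
      finally have "vnorm X (vadd X y (?T y)) \<le> 3 * (1 - p y)" using S(6)[OF y(1)] T by simp
      moreover have "vnorm X (vadd X y (?T y)) \<le> 1 + p y"
        using norm_triangle[of y "?T y"] yv v y by (simp add: norm_scale unit_ball_def)
      ultimately show ?thesis unfolding right_diff_distrib by linarith
    qed
    fix y assume y: "y \<in> unit_ball X"
    note yv = ball_vecs[OF y]
    show "vnorm X (vadd X y (?T y)) \<le> 3/2"
    proof (cases "p y \<ge> 0")
      case False
      let ?z = "vscale X (-1) y"
      have "vadd X ?z (?T ?z) = vscale X (-1) (vadd X y (?T y))"
        using yv S by (simp add: scale_add scale_scale dual_scale[OF S(2)] mult_ac)
      moreover have "vnorm X (vadd X ?z (?T ?z)) \<le> 3/2"
        using False yv by (intro * uminus_in_ball y) (simp add: dual_scale[OF S(2)])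
      ultimately show ?thesis using yv S by (simp add: norm_scale)
    qed (use * y in auto)
  qed
  ultimately show False by linarith
qed

section \<open>The Daugavet property via slices\<close>

lemma rank_one_decompose:
  assumes T: "bdd_lin_map X X T" "rank_one X X T"
  obtains p v where "p \<in> vecs (dual_space X)" "v \<in> vecs X" "vnorm (dual_space X) p > 0"
    "\<And>x. x \<in> vecs X \<Longrightarrow> T x = vscale X (p x) v"
proof -
  obtain v where v: "v \<in> vecs X" "v \<noteq> vzero X" and img: "T ` vecs X = range (\<lambda>c. vscale X c v)"
    using T(2) unfolding rank_one_def by blast
  have inj: "c = d" if "vscale X c v = vscale X d v" for c d
  proof -
    have "vscale X (c - d) v = vadd X (vscale X c v) (vscale X (-1) (vscale X d v))"
      using v add_scale[of v c "-d"] by (simp add: scale_scale)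
    also have "\<dots> = vzero X" using v by (simp add: that add_inverse)
    finally have "\<bar>c - d\<bar> * vnorm X v = 0" using v by (metis norm_scale norm_zero)
    then show ?thesis using v norm_zero_iff by simp
  qed
  have "\<forall>x\<in>vecs X. \<exists>c. T x = vscale X c v" using img by blast
  then obtain p0 where p0: "\<And>x. x \<in> vecs X \<Longrightarrow> T x = vscale X (p0 x) v" by metis
  define p where "p = restrict p0 (vecs X)"
  have p: "T x = vscale X (p x) v" if "x \<in> vecs X" for x using p0 that by (simp add: p_def)
  obtain K where K: "\<And>x. x \<in> vecs X \<Longrightarrow> vnorm X (T x) \<le> K * vnorm X x"
    using T(1) unfolding bdd_lin_map_def by blast
  have nv: "vnorm X v > 0" using norm_nonneg[OF v(1)] v norm_zero_iff by fastforce
  have pd: "p \<in> vecs (dual_space X)"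
    unfolding dual_iff
  proof (intro conjI ballI allI exI)
    show "p \<in> extensional (vecs X)" by (simp add: p_def)
    fix x assume x: "x \<in> vecs X"
    have "\<bar>p x\<bar> * vnorm X v \<le> K * vnorm X x" using K[OF x] p[OF x] v by (simp add: norm_scale)
    then show "\<bar>p x\<bar> \<le> (K / vnorm X v) * vnorm X x" using nv by (simp add: field_simps)
    fix c
    have "T (vscale X c x) = vscale X c (T x)"
      using T(1) x unfolding bdd_lin_map_def lin_map_def by blast
    then have "vscale X (p (vscale X c x)) v = vscale X (c * p x) v"
      using x v by (simp add: p scale_scale)
    then show "p (vscale X c x) = c * p x" by (rule inj)
  next
    fix x y assume xy: "x \<in> vecs X" "y \<in> vecs X"
    have "T (vadd X x y) = vadd X (T x) (T y)"
      using T(1) xy unfolding bdd_lin_map_def lin_map_def by blast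
    then have "vscale X (p (vadd X x y)) v = vscale X (p x + p y) v"
      using xy v by (simp add: p add_scale)
    then show "p (vadd X x y) = p x + p y" by (rule inj)
  qed
  have "vnorm (dual_space X) p \<noteq> 0"
  proof
    assume "vnorm (dual_space X) p = 0"
    then have "p x = 0" if "x \<in> vecs X" for x using dual_bound[OF pd that] by simp
    moreover have "vscale X 1 v \<in> T ` vecs X" using img by blast
    ultimately show False using p v by (auto simp: scale_one)
  qed
  then show ?thesis using that pd v p dual_norm_nonneg[OF pd] by force
qed

text \<open>
  A rank-one operator is \<open>x \<mapsto> p x\<close> times \<open>u\<close>, where \<open>p\<close> may be taken of norm one. On the slice where
  \<open>p x \<ge> 1 - e\<close> it is almost the constant \<open>u\<close>, so the Daugavet equation holds as soon as some \<open>x\<close> in the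
  slice has almost the largest possible distance from \<open>- u\<close>.
\<close>

lemma DaugavetI:
  assumes *: "\<And>p u e. \<lbrakk>p \<in> unit_sphere (dual_space X); u \<in> vecs X; 0 < e\<rbrakk>
    \<Longrightarrow> \<exists>x\<in>unit_ball X. p x \<ge> 1 - e \<and> vnorm X (vadd X x u) \<ge> 1 + vnorm X u - e"
  shows "Daugavet X"
  unfolding Daugavet_def
proof (intro allI impI, elim conjE)
  fix T assume T: "bdd_lin_map X X T" "rank_one X X T"
  obtain p0 v where p0: "p0 \<in> vecs (dual_space X)" "vnorm (dual_space X) p0 > 0"
    and v: "v \<in> vecs X" and T0: "\<And>x. x \<in> vecs X \<Longrightarrow> T x = vscale X (p0 x) v"
    using rank_one_decompose[OF T] by metis
  define n where "n = vnorm (dual_space X) p0"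
  have n: "n > 0" using p0 by (simp add: n_def)
  define p where "p = (\<lambda>x\<in>vecs X. (1 / n) * p0 x)"
  define u where "u = vscale X n v"
  have u: "u \<in> vecs X" using v by (simp add: u_def)
  have p: "p \<in> unit_sphere (dual_space X)"
    using dual_norm_scale[OF p0(1), of "1 / n"] n by (simp add: p_def unit_sphere_def n_def)
  have Tpu: "T x = vscale X (p x) u" if "x \<in> vecs X" for x
    using that v n by (simp add: T0 p_def u_def scale_scale)
  have p_le: "\<bar>p x\<bar> \<le> 1" if "x \<in> unit_ball X" for x
    using dual_sphere_bound[OF p] that by (force simp: unit_ball_def)
  have T_le: "vnorm X (T x) \<le> vnorm X u" if "x \<in> unit_ball X" for x
    using mult_right_mono[OF p_le[OF that] norm_nonneg[OF u]] ball_vecs[OF that] u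
    by (simp add: Tpu norm_scale)
  have Tv: "T x \<in> vecs X" if "x \<in> vecs X" for x using that u by (simp add: Tpu)
  let ?S = "\<lambda>x. vadd X x (T x)"
  have S_le: "vnorm X (?S x) \<le> 1 + vnorm X (T x)" if "x \<in> unit_ball X" for x
    using norm_triangle[of x "T x"] Tv ball_vecs[OF that] that by (simp add: unit_ball_def)
  show "op_norm X X ?S = 1 + op_norm X X T"
  proof (rule antisym)
    show "op_norm X X ?S \<le> 1 + op_norm X X T"
      using S_le op_norm_geI[of _ X T, OF _ T_le] by (intro op_norm_leI) (force intro: order_trans)
    have "op_norm X X T \<le> vnorm X u" using T_le by (rule op_norm_leI)
    moreover have "1 + vnorm X u \<le> op_norm X X ?S"
    proof (rule field_le_epsilon)
      fix e :: real assume e: "0 < e"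
      \<comment> \<open>Replacing \<open>T x\<close> by \<open>u\<close> costs up to \<open>d * vnorm X u\<close> on top of the error \<open>d\<close> of the choice of \<open>x\<close>.\<close>
      define d where "d = e / (1 + vnorm X u)"
      have u1: "1 + vnorm X u > 0" using norm_nonneg[OF u] by simp
      then have "d * (1 + vnorm X u) = e" by (simp add: d_def)
      then have d: "d > 0" "d + d * vnorm X u = e" using e u1 by (simp_all add: d_def distrib_left)
      obtain x where x: "x \<in> unit_ball X" "p x \<ge> 1 - d" "vnorm X (vadd X x u) \<ge> 1 + vnorm X u - d"
        using *[OF p u d(1)] by blast
      note xv = ball_vecs[OF x(1)]
      have "vadd X x u = vadd X (?S x) (vscale X (1 - p x) u)"
        using xv u add_scale[of u "p x" "1 - p x"] by (simp add: Tpu add_assoc scale_one)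
      then have "vnorm X (vadd X x u) \<le> vnorm X (?S x) + (1 - p x) * vnorm X u"
        using norm_triangle[of "?S x" "vscale X (1 - p x) u"] xv u Tv p_le[OF x(1)]
        by (simp add: norm_scale)
      also have "(1 - p x) * vnorm X u \<le> d * vnorm X u"
        using x(2) norm_nonneg[OF u] by (intro mult_right_mono) auto
      also have "vnorm X (?S x) \<le> op_norm X X ?S"
        using S_le T_le by (intro op_norm_geI[OF x(1), of _ _ "1 + vnorm X u"]) force
      finally show "1 + vnorm X u \<le> op_norm X X ?S + e" using x(3) d(2) by linarith
    qed
    ultimately show "1 + op_norm X X T \<le> op_norm X X ?S" by linarith
  qed
qed

section \<open>From separable to finite-dimensional subspaces\<close>

lemma lin_subspace_span: "F \<subseteq> vecs X \<Longrightarrow> lin_subspace X (lin_span X F)"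
  unfolding lin_span_def lin_subspace_def by auto

text \<open>
  Induction on the finite set: adding a line to a separable subspace keeps it separable, by taking
  rational multiples of the new vector. The subspace obtained contains the span of the set.
\<close>

lemma finite_subset_separable:
  "finite F \<Longrightarrow> F \<subseteq> vecs X \<Longrightarrow> \<exists>Y. lin_subspace X Y \<and> separable_in X Y \<and> F \<subseteq> Y"
proof (induction F rule: finite_induct)
  case empty
  have "lin_subspace X {vzero X}" by (simp add: lin_subspace_def add_zero)
  moreover have "separable_in X {vzero X}"
    unfolding separable_in_def
    by (intro exI[of _ "{vzero X}"]) (auto simp: vsub_def add_zero)
  ultimately show ?case by blast
next
  case (insert v F)
  then obtain Y where Y: "lin_subspace X Y" "separable_in X Y" "F \<subseteq> Y" and v: "v \<in> vecs X" by auto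
  then have Yv: "y \<in> vecs X" if "y \<in> Y" for y using that unfolding lin_subspace_def by blast
  obtain D where D: "countable D" "D \<subseteq> Y" and dense: "\<And>y e. \<lbrakk>y \<in> Y; e > 0\<rbrakk> \<Longrightarrow> \<exists>d\<in>D. vnorm X (vsub X y d) < e"
    using Y(2) unfolding separable_in_def by metis
  let ?f = "\<lambda>(y, c). vadd X y (vscale X c v)"
  let ?Y = "?f ` (Y \<times> UNIV)"
  let ?D = "?f ` (D \<times> \<rat>)"
  have Y0: "vzero X \<in> Y" and Yadd: "\<And>x y. \<lbrakk>x \<in> Y; y \<in> Y\<rbrakk> \<Longrightarrow> vadd X x y \<in> Y"
    and Yscale: "\<And>c x. x \<in> Y \<Longrightarrow> vscale X c x \<in> Y"
    using Y(1) unfolding lin_subspace_def by blast+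
  have "lin_subspace X ?Y"
    unfolding lin_subspace_def
  proof (intro conjI ballI allI)
    show "?Y \<subseteq> vecs X" using Yv v by auto
    show "vzero X \<in> ?Y" using Y0 v by (intro image_eqI[of _ _ "(vzero X, 0)"]) (auto simp: add_zero)
  next
    fix x y assume "x \<in> ?Y" "y \<in> ?Y"
    then obtain a c b d where "a \<in> Y" "b \<in> Y" "x = ?f (a, c)" "y = ?f (b, d)" by blast
    then show "vadd X x y \<in> ?Y" using Yadd Yv v
      by (intro image_eqI[of _ _ "(vadd X a b, c + d)"])
        (auto simp: add_scale add_assoc add_left_commute add_commute)
  next
    fix c x assume "x \<in> ?Y"
    then obtain a d where "a \<in> Y" "x = ?f (a, d)" by blast
    then show "vscale X c x \<in> ?Y" using Yscale Yv v
      by (intro image_eqI[of _ _ "(vscale X c a, c * d)"]) (auto simp: scale_add scale_scale)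
  qed
  moreover have "separable_in X ?Y"
    unfolding separable_in_def
  proof (intro exI[of _ ?D] conjI ballI allI impI)
    show "countable ?D" using D by (intro countable_image countable_SIGMA countable_rat) auto
    show "?D \<subseteq> ?Y" using D by auto
    fix x and e :: real assume "x \<in> ?Y" and e: "0 < e"
    then obtain a c where a: "a \<in> Y" and x: "x = vadd X a (vscale X c v)" by auto
    obtain d where d: "d \<in> D" "vnorm X (vsub X a d) < e / 2" using dense[OF a, of "e / 2"] e by auto
    have v1: "vnorm X v + 1 > 0" using norm_nonneg[OF v] by simp
    obtain r where r: "r \<in> \<rat>" "c < r" "r < c + e / (2 * (vnorm X v + 1))"
      using Rats_dense_in_real[of c "c + e / (2 * (vnorm X v + 1))"] e v1 by auto
    have dv: "d \<in> vecs X" using d D Yv by blast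
    have "\<bar>c - r\<bar> * vnorm X v \<le> e / (2 * (vnorm X v + 1)) * vnorm X v"
      using r norm_nonneg[OF v] by (intro mult_right_mono) auto
    also have "\<dots> \<le> e / 2" using e v1 norm_nonneg[OF v] by (simp add: field_simps)
    finally have cr: "\<bar>c - r\<bar> * vnorm X v \<le> e / 2" .
    have "vsub X x (?f (d, r)) = vadd X (vsub X a d) (vscale X (c - r) v)"
      using Yv[OF a] dv v add_scale[of v c "-r"]
      by (simp add: x vsub_def scale_add scale_scale add_assoc add_left_commute)
    then have "vnorm X (vsub X x (?f (d, r))) < e"
      using norm_triangle[of "vsub X a d" "vscale X (c - r) v"] Yv[OF a] dv v d(2) cr
      by (simp add: norm_scale)
    then show "\<exists>d\<in>?D. vnorm X (vsub X x d) < e" using d(1) r(1) by blast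
  qed
  moreover have "insert v F \<subseteq> ?Y"
  proof -
    have "v = ?f (vzero X, 1)" using v by (simp add: scale_one add_zero)
    moreover have "y = ?f (y, 0)" if "y \<in> F" for y using that Y(3) Yv v by (auto simp: add_zero)
    ultimately show ?thesis using Y0 Y(3) by blast
  qed
  ultimately show ?case by blast
qed

lemma octahedral_if_fails_m1_BCP_omega:
  assumes "fails_m1_BCP_omega X"
  shows "octahedral X"
  unfolding octahedral_def
proof (intro allI impI, elim conjE)
  fix Y and e :: real assume Y: "lin_subspace X Y" "fin_dim X Y" and e: "0 < e"
  then obtain F where F: "finite F" "F \<subseteq> Y" "lin_span X F = Y" unfolding fin_dim_def by blast
  moreover have "Y \<subseteq> vecs X" using Y unfolding lin_subspace_def by blast
  ultimately obtain Z where Z: "lin_subspace X Z" "separable_in X Z" "F \<subseteq> Z"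
    using finite_subset_separable by (metis order_trans)
  then have "Y \<subseteq> Z" using F unfolding lin_span_def by blast
  obtain x where x: "x \<in> unit_sphere X"
    and *: "\<And>y l. y \<in> Z \<Longrightarrow> vnorm X (vadd X y (vscale X l x)) \<ge> vnorm X y + \<bar>l\<bar>"
    using assms Z unfolding fails_m1_BCP_omega_def by meson
  show "\<exists>x\<in>unit_sphere X. \<forall>y\<in>Y. \<forall>l.
      (1 - e) * (vnorm X y + \<bar>l\<bar>) \<le> vnorm X (vadd X y (vscale X l x))"
  proof (intro bexI[OF _ x] ballI allI)
    fix y l assume "y \<in> Y"
    then have y: "y \<in> Z" "y \<in> vecs X" using \<open>Y \<subseteq> Z\<close> \<open>Y \<subseteq> vecs X\<close> by auto
    have "(1 - e) * (vnorm X y + \<bar>l\<bar>) \<le> 1 * (vnorm X y + \<bar>l\<bar>)"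
      using e norm_nonneg[OF y(2)] by (intro mult_right_mono) auto
    then show "(1 - e) * (vnorm X y + \<bar>l\<bar>) \<le> vnorm X (vadd X y (vscale X l x))"
      using *[OF y(1), of l] by simp
  qed
qed

section \<open>One-dimensional max-summands\<close>

text \<open>
  The space is the max-sum of the line through \<open>v\<close> and the kernel of \<open>q\<close>, where \<open>q\<close> is the coordinate
  on that line.
\<close>

definition line_max_summand :: "('v \<Rightarrow> real) \<Rightarrow> 'v \<Rightarrow> bool" where
  "line_max_summand q v \<longleftrightarrow> q \<in> vecs (dual_space X) \<and> v \<in> vecs X \<and> q v = 1 \<and>
     (\<forall>y\<in>vecs X. vnorm X y = max \<bar>q y\<bar> (vnorm X (vsub X y (vscale X (q y) v))))"

lemma
  assumes "line_max_summand q v"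
  shows line_max_summand_vecs: "q \<in> vecs (dual_space X)" "v \<in> vecs X"
    and line_max_summand_value: "q v = 1"
    and line_max_summand_eq:
      "y \<in> vecs X \<Longrightarrow> vnorm X y = max \<bar>q y\<bar> (vnorm X (vsub X y (vscale X (q y) v)))"
    and line_max_summand_norm: "vnorm X v = 1"
proof -
  show *: "q \<in> vecs (dual_space X)" "v \<in> vecs X" "q v = 1"
    "y \<in> vecs X \<Longrightarrow> vnorm X y = max \<bar>q y\<bar> (vnorm X (vsub X y (vscale X (q y) v)))" for y
    using assms unfolding line_max_summand_def by blast+
  have "vsub X v (vscale X (q v) v) = vzero X"
    using * by (simp add: vsub_def scale_one add_inverse)
  then show "vnorm X v = 1" using *(4)[OF *(2)] *(3) by simp
qed

text \<open>
  Subtracting the coordinate along \<open>v\<close> is the projection onto the other summand. It has norm at most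
  1, but it is the identity plus a rank-one operator of norm at least 1.
\<close>

lemma not_Daugavet_if_line_max_summand:
  assumes "line_max_summand q v"
  shows "\<not> Daugavet X"
proof
  assume D: "Daugavet X"
  note L = line_max_summand_vecs[OF assms] line_max_summand_value[OF assms]
    line_max_summand_norm[OF assms]
  note max_eq = line_max_summand_eq[OF assms]
  let ?w = "vscale X (-1) v"
  let ?T = "\<lambda>y. vscale X (q y) ?w"
  have w: "?w \<in> vecs X" "vnorm X ?w = 1" using L by (simp_all add: norm_scale)
  then have "?w \<noteq> vzero X" by auto
  from rank_one_operator[OF L(1) w(1) this L(2)] L(3) D
  have "op_norm X X (\<lambda>y. vadd X y (?T y)) = 1 + op_norm X X ?T"
    unfolding Daugavet_def by simp
  moreover have "1 \<le> op_norm X X ?T"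
  proof -
    have "\<bar>q y\<bar> \<le> 1" if "y \<in> unit_ball X" for y
      using max_eq[OF ball_vecs[OF that]] that by (simp add: unit_ball_def)
    then have "vnorm X (?T v) \<le> op_norm X X ?T"
      using L w by (intro op_norm_geI[of _ _ _ 1]) (auto simp: unit_ball_def norm_scale)
    then show ?thesis using L w by (simp add: norm_scale)
  qed
  moreover have "op_norm X X (\<lambda>y. vadd X y (?T y)) \<le> 1"
  proof (rule op_norm_leI)
    fix y assume y: "y \<in> unit_ball X"
    have "vadd X y (?T y) = vsub X y (vscale X (q y) v)"
      using L by (simp add: vsub_def scale_scale mult.commute)
    then show "vnorm X (vadd X y (?T y)) \<le> 1"
      using max_eq[OF ball_vecs[OF y]] y by (simp add: unit_ball_def)
  qed
  ultimately show False by linarith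
qed

text \<open>
  The coordinate of a unit vector \<open>x\<close> along \<open>v\<close> is, after a change of sign, not positive. Then adding
  \<open>x\<close> to \<open>2 v\<close> does not increase the norm beyond 2, neither on the line nor on the other summand.
\<close>

lemma not_octahedral_if_line_max_summand:
  assumes "line_max_summand q v"
  shows "\<not> octahedral X"
proof
  assume O: "octahedral X"
  note L = line_max_summand_vecs[OF assms] line_max_summand_value[OF assms]
    line_max_summand_norm[OF assms]
  note max_eq = line_max_summand_eq[OF assms]
  let ?Y = "lin_span X {v}"
  have sub: "lin_subspace X ?Y" using L by (intro lin_subspace_span) auto
  have vY: "v \<in> ?Y" by (auto simp: lin_span_def)
  then have "fin_dim X ?Y" unfolding fin_dim_def by (intro exI[of _ "{v}"]) auto
  \<comment> \<open>With tolerance 1/4 the sum would have norm at least \<open>(3/4) * (2 + 1) > 2\<close>.\<close>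
  with O sub obtain x where x: "x \<in> unit_sphere X"
    and big: "\<And>y l. y \<in> ?Y \<Longrightarrow> (1 - 1/4) * (vnorm X y + \<bar>l\<bar>) \<le> vnorm X (vadd X y (vscale X l x))"
    unfolding octahedral_def by (metis zero_less_divide_1_iff zero_less_numeral)
  have xv: "x \<in> vecs X" "vnorm X x = 1" using x by (auto simp: unit_sphere_def)
  define s :: real where "s = (if q x \<ge> 0 then -1 else 1)"
  have s: "\<bar>s\<bar> = 1" by (simp add: s_def)
  let ?y = "vadd X (vscale X 2 v) (vscale X s x)"
  have yv: "?y \<in> vecs X" using L xv by simp
  have qx: "\<bar>q x\<bar> \<le> 1" "vnorm X (vsub X x (vscale X (q x) v)) \<le> 1" using max_eq[OF xv(1)] xv by auto
  have qy: "q ?y = 2 + s * q x" using L xv by (simp add: dual_add[OF L(1)] dual_scale[OF L(1)])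
  then have "\<bar>q ?y\<bar> \<le> 2" using qx by (auto simp: s_def)
  moreover have "vsub X ?y (vscale X (q ?y) v) = vscale X s (vsub X x (vscale X (q x) v))"
  proof -
    have "vsub X ?y (vscale X (q ?y) v)
        = vadd X (vscale X s x) (vadd X (vscale X 2 v) (vscale X (-2 - s * q x) v))"
      unfolding qy using L xv by (simp add: vsub_def scale_scale add_assoc add_left_commute)
    also have "vadd X (vscale X 2 v) (vscale X (-2 - s * q x) v) = vscale X (- (s * q x)) v"
      using add_scale[OF L(2), of 2 "-2 - s * q x"] by simp
    finally show ?thesis using L xv by (simp add: vsub_def scale_scale scale_add)
  qed
  then have "vnorm X (vsub X ?y (vscale X (q ?y) v)) \<le> 1" using L xv qx s by (simp add: norm_scale)
  ultimately have "vnorm X ?y \<le> 2" using max_eq[OF yv] by simp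
  moreover have "vscale X 2 v \<in> ?Y" using sub vY unfolding lin_subspace_def by blast
  ultimately show False using big[of "vscale X 2 v" s] L s by (simp add: norm_scale)
qed

end

section \<open>Disjoint sets in atomless measures, and averages over atoms\<close>

text \<open>
  Finite measure is expressed by \<open>fmeasurable\<close>, so that the real-valued \<open>measure\<close> can be used for the
  subsets.
\<close>

definition semifinite :: "'a measure \<Rightarrow> bool" where
  "semifinite M \<longleftrightarrow> (\<forall>A\<in>sets M. 0 < emeasure M A \<longrightarrow>
     (\<exists>B\<in>fmeasurable M. B \<subseteq> A \<and> 0 < measure M B))"

text \<open>
  A set that is not an atom splits into two pieces of positive measure, and one of them has at most
  half of the measure.
\<close>

lemma atomless_halving:
  assumes "atomless M" "C \<in> fmeasurable M" "0 < measure M C"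
  shows "\<exists>B\<in>fmeasurable M. B \<subseteq> C \<and> 0 < measure M B \<and> measure M B \<le> measure M C / 2"
proof -
  have C: "C \<in> sets M" "emeasure M C > 0"
    using assms by (auto simp: emeasure_eq_measure2)
  have "\<not> atom M C" using assms(1) by (simp add: atomless_def)
  then obtain B where B: "B \<in> sets M" "B \<subseteq> C" "emeasure M B \<noteq> 0" "emeasure M (C - B) \<noteq> 0"
    using C unfolding atom_def by auto
  then have f: "B \<in> fmeasurable M" "C - B \<in> fmeasurable M"
    using assms(2) by (auto intro: fmeasurableI2)
  then have pos: "0 < measure M B" "0 < measure M (C - B)"
    using B by (auto simp: emeasure_eq_measure2 zero_less_measure_iff)
  have "measure M C = measure M B + measure M (C - B)"
    using measurable_measure_Diff[OF assms(2) B(1,2)] by simp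
  then have "measure M B \<le> measure M C / 2 \<or> measure M (C - B) \<le> measure M C / 2" by linarith
  then show ?thesis
  proof
    assume "measure M B \<le> measure M C / 2"
    then show ?thesis using f pos B by blast
  next
    assume "measure M (C - B) \<le> measure M C / 2"
    then show ?thesis using f pos by (intro bexI[of _ "C - B"]) auto
  qed
qed

lemma atomless_small_subset:
  assumes "atomless M" "semifinite M" "A \<in> sets M" "0 < emeasure M A" "0 < e"
  shows "\<exists>B\<in>fmeasurable M. B \<subseteq> A \<and> 0 < measure M B \<and> measure M B \<le> e"
proof -
  obtain C where C: "C \<in> fmeasurable M" "C \<subseteq> A" "0 < measure M C"
    using assms unfolding semifinite_def by blast
  have iter: "\<exists>B\<in>fmeasurable M. B \<subseteq> C \<and> 0 < measure M B \<and> measure M B \<le> measure M C / 2 ^ n" for n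
  proof (induction n)
    case 0
    show ?case using C by (intro bexI[of _ C]) auto
  next
    case (Suc n)
    then obtain B where B: "B \<in> fmeasurable M" "B \<subseteq> C" "0 < measure M B" "measure M B \<le> measure M C / 2 ^ n"
      by blast
    obtain B' where "B' \<in> fmeasurable M" "B' \<subseteq> B" "0 < measure M B'" "measure M B' \<le> measure M B / 2"
      using atomless_halving[OF assms(1) B(1,3)] by blast
    with B show ?case by (intro bexI[of _ B']) auto
  qed
  obtain n where "measure M C / e < 2 ^ n" using real_arch_pow[of 2 "measure M C / e"] by auto
  then have "measure M C / 2 ^ n \<le> e" using assms(5) by (simp add: field_simps)
  moreover obtain B where "B \<in> fmeasurable M" "B \<subseteq> C" "0 < measure M B" "measure M B \<le> measure M C / 2 ^ n"
    using iter by blast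
  ultimately show ?thesis using C(2) by (intro bexI[of _ B]) auto
qed

text \<open>
  Choose \<open>C n\<close> inside \<open>A n\<close> so small, compared with its predecessors, that all later sets together
  cannot exhaust \<open>C n\<close>; then remove the later sets from \<open>C n\<close>.
\<close>

lemma disjoint_refinement:
  assumes M: "atomless M" "semifinite M" and A: "\<And>n::nat. A n \<in> sets M" "\<And>n. 0 < emeasure M (A n)"
  obtains B where "\<And>n. B n \<in> fmeasurable M" "\<And>n. B n \<subseteq> A n" "\<And>n. 0 < measure M (B n)"
    "disjoint_family B"
proof -
  let ?P = "\<lambda>n C. C \<in> fmeasurable M \<and> C \<subseteq> A n \<and> 0 < measure M C"
  \<comment> \<open>With ratio 1/4 the later sets take at most \<open>1/4 + 1/16 + \<dots> = 1/3\<close> of \<open>C n\<close>.\<close>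
  have "\<exists>C. \<forall>n. ?P n (C n) \<and> measure M (C (Suc n)) \<le> measure M (C n) / 4"
  proof (rule dependent_nat_choice)
    show "\<exists>C. ?P 0 C" using atomless_small_subset[OF M A, of 1] by auto
    show "\<exists>C'. ?P (Suc n) C' \<and> measure M C' \<le> measure M C / 4" if "?P n C" for n C
      using atomless_small_subset[OF M A, of "measure M C / 4" "Suc n"] that by auto
  qed
  then obtain C where C: "\<And>n. C n \<in> fmeasurable M" "\<And>n. C n \<subseteq> A n" "\<And>n. 0 < measure M (C n)"
    and step: "\<And>n. measure M (C (Suc n)) \<le> measure M (C n) / 4"
    by blast
  have decay: "measure M (C (n + k)) \<le> measure M (C n) * (1 / 4) ^ k" for n k
  proof (induction k)
    case (Suc k)
    then show ?case using step[of "n + k"] by simp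
  qed simp
  define U where "U n = (\<Union>k. C (Suc n + k))" for n
  have U: "U n \<in> sets M" for n using C(1) by (auto simp: U_def)
  have U_small: "emeasure M (U n) \<le> ennreal (measure M (C n) / 3)" for n
  proof -
    have "emeasure M (U n) \<le> (\<Sum>k. emeasure M (C (Suc n + k)))"
      unfolding U_def using C(1) by (intro emeasure_subadditive_countably) auto
    also have "\<dots> \<le> (\<Sum>k. ennreal (measure M (C n) / 4 * (1 / 4) ^ k))"
    proof (intro suminf_le summableI)
      fix k
      have "measure M (C (Suc n + k)) \<le> measure M (C n) / 4 * (1 / 4) ^ k"
        using decay[of n "Suc k"] by simp
      then show "emeasure M (C (Suc n + k)) \<le> ennreal (measure M (C n) / 4 * (1 / 4) ^ k)"
        using C(1) by (simp add: emeasure_eq_measure2 ennreal_leI)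
    qed
    also have "\<dots> = ennreal (measure M (C n) / 3)"
    proof (rule suminf_ennreal_eq)
      have "(\<lambda>k. measure M (C n) / 4 * (1 / 4) ^ k) sums (measure M (C n) / 4 * (1 / (1 - 1 / 4)))"
        by (intro sums_mult geometric_sums) simp
      then show "(\<lambda>k. measure M (C n) / 4 * (1 / 4) ^ k) sums (measure M (C n) / 3)" by simp
    qed simp
    finally show ?thesis .
  qed
  define B where "B n = C n - U n" for n
  show thesis
  proof
    show B: "B n \<in> fmeasurable M" for n
      unfolding B_def using C(1) U by (rule fmeasurable_Diff)
    show "B n \<subseteq> A n" for n using C(2) by (auto simp: B_def)
    show "0 < measure M (B n)" for n
    proof -
      have I: "C n \<inter> U n \<in> fmeasurable M" using C(1) U by (auto intro: fmeasurableI2)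
      have "emeasure M (C n \<inter> U n) \<le> emeasure M (U n)" using U by (intro emeasure_mono) auto
      then have "ennreal (measure M (C n \<inter> U n)) \<le> ennreal (measure M (C n) / 3)"
        using order_trans[OF _ U_small[of n]] I by (simp add: emeasure_eq_measure2)
      then have "measure M (C n \<inter> U n) \<le> measure M (C n) / 3" by (simp add: ennreal_le_iff)
      moreover have "measure M (B n \<union> (C n \<inter> U n)) \<le> measure M (B n) + measure M (C n \<inter> U n)"
        using B I by (intro measure_Un_le) auto
      moreover have "B n \<union> (C n \<inter> U n) = C n" by (auto simp: B_def)
      ultimately show ?thesis using C(3)[of n] by simp
    qed
    have "B m \<inter> B n = {}" if "m < n" for m n
    proof -
      have "C n \<subseteq> U m" using UN_upper[of "n - Suc m" UNIV "\<lambda>k. C (Suc m + k)"] that by (simp add: U_def)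
      then show ?thesis by (auto simp: B_def)
    qed
    then show "disjoint_family B"
      unfolding disjoint_family_on_def by (metis inf_commute linorder_neqE_nat)
  qed
qed

lemma disjoint_sign_pattern:
  fixes s :: "nat \<Rightarrow> real"
  assumes M: "atomless M" "semifinite M" and A: "\<And>n::nat. A n \<in> sets M" "\<And>n. 0 < emeasure M (A n)"
    and s: "\<And>n. \<bar>s n\<bar> = 1"
  obtains B g where "\<And>n. B n \<in> fmeasurable M" "\<And>n. B n \<subseteq> A n" "\<And>n. 0 < measure M (B n)"
    "g \<in> borel_measurable M" "\<And>x. \<bar>g x\<bar> \<le> 1" "\<And>n x. x \<in> B n \<Longrightarrow> g x = s n"
proof -
  obtain B where B: "\<And>n. B n \<in> fmeasurable M" "\<And>n. B n \<subseteq> A n" "\<And>n. 0 < measure M (B n)"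
    "disjoint_family B"
    using disjoint_refinement[of M A, OF M A] by blast
  define P where "P c = (\<Union>n\<in>{n. s n = c}. B n)" for c
  have P: "P c \<in> sets M" for c unfolding P_def using B(1) by (intro sets.countable_UN') auto
  have disj: "m = n" if "x \<in> B m" "x \<in> B n" for x m n
    using B(4) that unfolding disjoint_family_on_def by blast
  let ?g = "\<lambda>x. indicator (P 1) x - indicator (P (-1)) x :: real"
  show thesis
  proof (rule that[OF B(1,2,3), of ?g])
    show "?g \<in> borel_measurable M" using P by measurable
    show "\<bar>?g x\<bar> \<le> 1" for x by (auto simp: indicator_def)
    fix n x assume x: "x \<in> B n"
    have P_iff: "x \<in> P c \<longleftrightarrow> s n = c" for c unfolding P_def using disj x by blast
    have "s n = 1 \<or> s n = -1" using s[of n] by linarith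
    then show "?g x = s n" by (elim disjE) (simp_all add: P_iff)
  qed
qed

lemma abs_signed_indicator_sum_le_one:
  fixes s :: "nat \<Rightarrow> real"
  assumes B: "disjoint_family B" and s: "\<And>n. \<bar>s n\<bar> \<le> 1"
  shows "\<bar>\<Sum>n<N. s n * indicator (B n) x\<bar> \<le> 1"
proof -
  have "\<bar>\<Sum>n<N. s n * indicator (B n) x\<bar> \<le> (\<Sum>n<N. \<bar>s n * indicator (B n) x\<bar>)"
    by (rule sum_abs)
  also have "\<dots> \<le> (\<Sum>n<N. indicator (B n) x)"
    using s by (intro sum_mono) (simp add: abs_mult indicator_def)
  also have "\<dots> = (indicator (\<Union>n<N. B n) x :: real)"
    using disjoint_family_on_mono[OF _ B, of "{..<N}"] by (subst indicator_UN_disjoint) auto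
  also have "\<dots> \<le> 1" by (simp add: indicator_def)
  finally show ?thesis .
qed

text \<open>
  The integrals over disjoint sets add up to at most the integral of \<open>\<bar>u\<bar>\<close>, which is finite.
\<close>

lemma small_integral_on_disjoint_sets:
  fixes u :: "'a \<Rightarrow> real"
  assumes u: "integrable M u" and B: "\<And>n::nat. B n \<in> sets M" "disjoint_family B" and e: "0 < e"
  shows "\<exists>n. (LINT x|M. indicator (B n) x * \<bar>u x\<bar>) < e"
proof (rule ccontr)
  assume "\<not> ?thesis"
  then have ge: "e \<le> (LINT x|M. indicator (B n) x * \<bar>u x\<bar>)" for n by (simp add: not_less)
  have int: "integrable M (\<lambda>x. indicator (B n) x * \<bar>u x\<bar>)" for n
    using integrable_mult_indicator[OF B(1), of "\<lambda>x. \<bar>u x\<bar>"] u by simp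
  have "real N * e \<le> (LINT x|M. \<bar>u x\<bar>)" for N
  proof -
    have "real N * e \<le> (\<Sum>n<N. LINT x|M. indicator (B n) x * \<bar>u x\<bar>)"
      using sum_mono[of "{..<N}" "\<lambda>_. e", OF ge] by simp
    also have "\<dots> = (LINT x|M. (\<Sum>n<N. indicator (B n) x * \<bar>u x\<bar>))"
      using int by (subst Bochner_Integration.integral_sum) auto
    also have "\<dots> \<le> (LINT x|M. \<bar>u x\<bar>)"
    proof (rule integral_mono)
      fix x
      have "(\<Sum>n<N. indicator (B n) x) \<le> (1::real)"
        using abs_signed_indicator_sum_le_one[OF B(2), of "\<lambda>_. 1" x N] unfolding mult_1 by simp
      then have "(\<Sum>n<N. indicator (B n) x) * \<bar>u x\<bar> \<le> 1 * \<bar>u x\<bar>"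
        by (rule mult_right_mono) simp
      then show "(\<Sum>n<N. indicator (B n) x * \<bar>u x\<bar>) \<le> \<bar>u x\<bar>" by (simp add: sum_distrib_right)
    next
      show "integrable M (\<lambda>x. \<Sum>n<N. indicator (B n) x * \<bar>u x\<bar>)"
        using int by (intro Bochner_Integration.integrable_sum)
    qed (use u in auto)
    finally show ?thesis .
  qed
  moreover obtain N where "(LINT x|M. \<bar>u x\<bar>) < real N * e" using reals_Archimedean3[OF e] by blast
  ultimately show False by (simp add: not_less[symmetric])
qed

text \<open>
  The difference \<open>g\<close> of \<open>f\<close> and its average over \<open>A\<close> has integral 0 over \<open>A\<close>. One of the sets where
  \<open>g \<le> 0\<close> and where \<open>g > 0\<close> is null in \<open>A\<close>, so \<open>g\<close> has constant sign almost everywhere on \<open>A\<close> and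
  hence vanishes there.
\<close>

lemma AE_const_on_atom:
  fixes f :: "'a \<Rightarrow> real"
  assumes A: "atom M A" "A \<in> fmeasurable M"
    and f: "f \<in> borel_measurable M" "integrable M (\<lambda>x. indicator A x * f x)"
  shows "AE x in M. x \<in> A \<longrightarrow> f x = (LINT x|M. indicator A x * f x) / measure M A"
proof -
  have [measurable]: "A \<in> sets M" "f \<in> borel_measurable M" using A f by auto
  have mA: "0 < measure M A" using A by (auto simp: atom_def emeasure_eq_measure2)
  define c where "c = (LINT x|M. indicator A x * f x) / measure M A"
  let ?g = "\<lambda>x. indicator A x * f x - c * indicator A x"
  have indA: "integrable M (\<lambda>x. indicator A x :: real)"
    using A(2) by (simp add: fmeasurable_def)
  have int: "integrable M ?g" using f indA by auto
  have zero: "(LINT x|M. ?g x) = 0"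
    using f(2) indA mA A(2) by (simp add: c_def)
  let ?B = "{x \<in> A. f x \<le> c}"
  have BM: "?B = {x \<in> space M. x \<in> A \<and> f x \<le> c}"
    using sets.sets_into_space[of A M] by auto
  have "?B \<in> sets M" unfolding BM by measurable
  moreover have "?B \<subseteq> A" by auto
  ultimately consider "emeasure M ?B = 0" | "emeasure M (A - ?B) = 0" using A unfolding atom_def by blast
  then have "AE x in M. ?g x = 0"
  proof cases
    case 1
    have "AE x in M. x \<notin> ?B" using \<open>?B \<in> sets M\<close> 1 by (intro AE_not_in) auto
    then have "AE x in M. 0 \<le> ?g x" by eventually_elim (auto simp: indicator_def)
    then show ?thesis using integral_nonneg_eq_0_iff_AE[OF int] zero by simp
  next
    case 2
    have "AE x in M. x \<notin> A - ?B" using \<open>?B \<in> sets M\<close> 2 by (intro AE_not_in) auto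
    then have "AE x in M. 0 \<le> - ?g x" by eventually_elim (auto simp: indicator_def)
    then show ?thesis
      using integral_nonneg_eq_0_iff_AE[of M "\<lambda>x. - ?g x"] int zero by (simp del: minus_diff_eq)
  qed
  then show ?thesis unfolding c_def[symmetric] by eventually_elim (auto simp: indicator_def)
qed

section \<open>Computing with classes of functions\<close>

interpretation L1: real_normed_space "L1 M" for M :: "'a measure"
  by (rule real_normed_space_L1)

interpretation Linf: real_normed_space "Linf M" for M :: "'a measure"
  by (rule real_normed_space_Linf)

lemma L1_vecsE:
  assumes "u \<in> vecs (L1 M)"
  obtains f where "integrable M f" "u = ae_class M f"
  using assms by (auto simp: L1_def)

lemma L1_vecs: "integrable M f \<Longrightarrow> ae_class M f \<in> vecs (L1 M)"
  by (auto simp: L1_def)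

lemma L1_norm: "f \<in> borel_measurable M \<Longrightarrow> vnorm (L1 M) (ae_class M f) = (LINT x|M. \<bar>f x\<bar>)"
  by (simp add: L1_def integral_abs_rep)

lemma L1_add:
  "\<lbrakk>f \<in> borel_measurable M; g \<in> borel_measurable M\<rbrakk>
    \<Longrightarrow> vadd (L1 M) (ae_class M f) (ae_class M g) = ae_class M (\<lambda>x. f x + g x)"
  by (simp add: L1_def ae_class_rep_add)

lemma L1_scale:
  "f \<in> borel_measurable M \<Longrightarrow> vscale (L1 M) c (ae_class M f) = ae_class M (\<lambda>x. c * f x)"
  by (simp add: L1_def ae_class_rep_scale)

lemma L1_sub:
  "\<lbrakk>f \<in> borel_measurable M; g \<in> borel_measurable M\<rbrakk>
    \<Longrightarrow> vsub (L1 M) (ae_class M f) (ae_class M g) = ae_class M (\<lambda>x. f x - g x)"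
  by (simp add: vsub_def L1_scale L1_add)

lemma Linf_norm_AE:
  assumes "f \<in> borel_measurable M" "ae_class M f \<in> vecs (Linf M)"
  shows "AE x in M. \<bar>f x\<bar> \<le> vnorm (Linf M) (ae_class M f)"
proof -
  obtain C where C: "AE x in M. \<bar>f x\<bar> \<le> C" using assms by (auto simp: Linf_vecs_iff)
  have "AE x in M. \<bar>f x\<bar> \<le> max 0 C" using C by eventually_elim auto
  then have "esssup M (\<lambda>x. ereal \<bar>f x\<bar>) < \<infinity>" by (rule esssup_abs_leI[OF assms(1)]) simp
  from esssup_abs_bound[OF assms(1) this] show ?thesis
    using assms(1) by (simp add: Linf_def esssup_abs_rep)
qed

lemma Linf_vecsE:
  assumes "u \<in> vecs (Linf M)"
  obtains f where "f \<in> borel_measurable M" "u = ae_class M f" "AE x in M. \<bar>f x\<bar> \<le> vnorm (Linf M) u"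
proof -
  obtain f where f: "f \<in> borel_measurable M" "u = ae_class M f" using assms by (auto simp: Linf_def)
  with Linf_norm_AE[OF f(1)] assms show thesis by (intro that[of f]) simp_all
qed

lemma Linf_vecs:
  "\<lbrakk>f \<in> borel_measurable M; AE x in M. \<bar>f x\<bar> \<le> C\<rbrakk> \<Longrightarrow> ae_class M f \<in> vecs (Linf M)"
  by (auto simp: Linf_vecs_iff)

lemma Linf_norm_leI:
  "\<lbrakk>f \<in> borel_measurable M; AE x in M. \<bar>f x\<bar> \<le> C; 0 \<le> C\<rbrakk> \<Longrightarrow> vnorm (Linf M) (ae_class M f) \<le> C"
  using esssup_abs_leI(2) by (simp add: Linf_def esssup_abs_rep)

lemma Linf_add:
  "\<lbrakk>f \<in> borel_measurable M; g \<in> borel_measurable M\<rbrakk>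
    \<Longrightarrow> vadd (Linf M) (ae_class M f) (ae_class M g) = ae_class M (\<lambda>x. f x + g x)"
  by (simp add: Linf_def ae_class_rep_add)

lemma Linf_scale:
  "f \<in> borel_measurable M \<Longrightarrow> vscale (Linf M) c (ae_class M f) = ae_class M (\<lambda>x. c * f x)"
  by (simp add: Linf_def ae_class_rep_scale)

lemma Linf_sub:
  "\<lbrakk>f \<in> borel_measurable M; g \<in> borel_measurable M\<rbrakk>
    \<Longrightarrow> vsub (Linf M) (ae_class M f) (ae_class M g) = ae_class M (\<lambda>x. f x - g x)"
  by (simp add: vsub_def Linf_scale Linf_add)

lemma Linf_norm_geI:
  assumes f: "f \<in> borel_measurable M" "ae_class M f \<in> vecs (Linf M)"
    and B: "B \<in> sets M" "0 < emeasure M B" and ge: "AE x in M. x \<in> B \<longrightarrow> c \<le> \<bar>f x\<bar>"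
  shows "c \<le> vnorm (Linf M) (ae_class M f)"
proof (rule ccontr)
  assume less: "\<not> ?thesis"
  have "AE x in M. x \<notin> B" using Linf_norm_AE[OF f] ge by eventually_elim (use less in auto)
  then have "B \<in> null_sets M" using AE_iff_null_sets[OF B(1)] by blast
  then show False using B(2) by auto
qed

text \<open>
  The hypothesis that the measure is not zero covers the case of a negative bound \<open>c\<close>, which occurs
  for functions that vanish almost everywhere.
\<close>

lemma Linf_nearly_attained:
  assumes f: "f \<in> borel_measurable M" "ae_class M f \<in> vecs (Linf M)"
    and M: "0 < emeasure M (space M)" and c: "c < vnorm (Linf M) (ae_class M f)"
  obtains s :: real and A where "\<bar>s\<bar> = 1" "A \<in> sets M" "0 < emeasure M A" "\<And>x. x \<in> A \<Longrightarrow> c < s * f x"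
proof (rule ccontr)
  assume "\<not> thesis"
  note none = this and found = that
  note [measurable] = f(1)
  have null: "AE x in M. \<not> c < s * f x" if s: "\<bar>s\<bar> = 1" for s :: real
  proof -
    let ?A = "{x \<in> space M. c < s * f x}"
    have A: "?A \<in> sets M" by measurable
    have "emeasure M ?A = 0" using found[OF s A] none by (metis (mono_tags, lifting) gr_zeroI mem_Collect_eq)
    then have "AE x in M. x \<notin> ?A" using A by (intro AE_not_in) auto
    then show ?thesis using AE_space by eventually_elim auto
  qed
  have le: "AE x in M. \<bar>f x\<bar> \<le> c"
    using null[of 1, simplified] null[of "-1", simplified] by eventually_elim auto
  show False
  proof (cases "0 \<le> c")
    case True
    then show False using Linf_norm_leI[OF f(1) le] c by simp
  next
    case False
    have "AE x in M. x \<notin> space M" using le by eventually_elim (use False in auto)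
    then have "space M \<in> null_sets M" using AE_iff_null_sets[OF sets.top] by blast
    then show False using M by auto
  qed
qed

lemma integrable_mult_AE_bounded:
  fixes f g :: "'a \<Rightarrow> real"
  assumes f: "integrable M f" and g: "g \<in> borel_measurable M" "AE x in M. \<bar>g x\<bar> \<le> C"
  shows "integrable M (\<lambda>x. f x * g x)"
proof (rule Bochner_Integration.integrable_bound)
  show "integrable M (\<lambda>x. C * f x)" using f by simp
  show "(\<lambda>x. f x * g x) \<in> borel_measurable M" using f g by measurable
  show "AE x in M. norm (f x * g x) \<le> norm (C * f x)"
    using g(2)
  proof eventually_elim
    case (elim x)
    then have "\<bar>f x\<bar> * \<bar>g x\<bar> \<le> \<bar>f x\<bar> * \<bar>C\<bar>" by (intro mult_left_mono) auto
    then show ?case by (simp add: abs_mult mult.commute)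
  qed
qed

lemma canonical_duality_ae_class:
  assumes f: "integrable M f" and g: "g \<in> borel_measurable M"
  shows "canonical_duality M (ae_class M g) (ae_class M f) = (LINT x|M. f x * g x)"
proof -
  have f': "f \<in> borel_measurable M" using f by simp
  note [measurable] = rep_ae_class(1)[OF f'] rep_ae_class(1)[OF g] f' g
  have "AE x in M. rep (ae_class M f) x * rep (ae_class M g) x = f x * g x"
    using rep_ae_class(2)[OF f'] rep_ae_class(2)[OF g] by eventually_elim simp
  then have "(LINT x|M. rep (ae_class M f) x * rep (ae_class M g) x) = (LINT x|M. f x * g x)"
    by (intro integral_cong_AE) measurable
  then show ?thesis using L1_vecs[OF f] by (simp add: canonical_duality_def)
qed

lemma
  assumes "localizable M" "v \<in> vecs (Linf M)"
  shows canonical_duality_vecs: "canonical_duality M v \<in> vecs (dual_space (L1 M))"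
    and canonical_duality_norm:
      "vnorm (dual_space (L1 M)) (canonical_duality M v) = vnorm (Linf M) v"
  using assms unfolding localizable_def isometric_isomorphism_def lin_map_def by blast+

lemma dual_L1_E:
  assumes "localizable M" "p \<in> vecs (dual_space (L1 M))"
  obtains g where "g \<in> borel_measurable M" "ae_class M g \<in> vecs (Linf M)"
    "p = canonical_duality M (ae_class M g)"
    "vnorm (Linf M) (ae_class M g) = vnorm (dual_space (L1 M)) p"
proof -
  have "p \<in> canonical_duality M ` vecs (Linf M)"
    using assms unfolding localizable_def isometric_isomorphism_def bij_betw_def by blast
  then obtain v where v: "v \<in> vecs (Linf M)" "p = canonical_duality M v" by blast
  obtain g where "g \<in> borel_measurable M" "v = ae_class M g" using v(1) by (rule Linf_vecsE)
  with v canonical_duality_norm[OF assms(1) v(1)] show thesis by (intro that[of g]) auto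
qed

lemma indicator_Linf: "A \<in> sets M \<Longrightarrow> ae_class M (indicator A :: _ \<Rightarrow> real) \<in> vecs (Linf M)"
  by (rule Linf_vecs[of _ _ 1]) (auto simp: indicator_def)

lemma norm_indicator_Linf:
  assumes "A \<in> sets M" "0 < emeasure M A"
  shows "vnorm (Linf M) (ae_class M (indicator A :: _ \<Rightarrow> real)) = 1"
proof (rule antisym)
  show "vnorm (Linf M) (ae_class M (indicator A :: _ \<Rightarrow> real)) \<le> 1"
    using assms by (intro Linf_norm_leI) (auto simp: indicator_def)
  show "1 \<le> vnorm (Linf M) (ae_class M (indicator A :: _ \<Rightarrow> real))"
    using assms indicator_Linf by (intro Linf_norm_geI[of _ _ A]) auto
qed

text \<open>
  The indicator of a set of positive measure has norm one in Linf, so the functional that it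
  induces on L1 is not zero, and some integrable function does not vanish on the set. Its level sets
  have finite measure by Markov's inequality.
\<close>

lemma semifinite_if_localizable:
  assumes "localizable M"
  shows "semifinite M"
  unfolding semifinite_def
proof (intro ballI impI)
  fix A assume A: "A \<in> sets M" "0 < emeasure M A"
  let ?g = "indicator A :: 'a \<Rightarrow> real"
  let ?p = "canonical_duality M (ae_class M ?g)"
  note [measurable] = A(1)
  have p: "?p \<in> vecs (dual_space (L1 M))" "vnorm (dual_space (L1 M)) ?p = 1"
    using canonical_duality_vecs[OF assms indicator_Linf[OF A(1)]]
      canonical_duality_norm[OF assms indicator_Linf[OF A(1)]] norm_indicator_Linf[OF A] by simp_all
  obtain u where u: "u \<in> unit_ball (L1 M)" "0 < ?p u"
    using L1.dual_norm_attained_nearly[OF p(1), of 0] p(2) by auto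
  obtain f where f: "integrable M f" "u = ae_class M f" using L1.ball_vecs[OF u(1)] by (rule L1_vecsE)
  have [measurable]: "f \<in> borel_measurable M" using f by simp
  have pos: "0 < (LINT x|M. f x * ?g x)" using u f by (simp add: canonical_duality_ae_class)
  define S where "S n = {x \<in> space M. inverse (real (Suc n)) \<le> \<bar>f x\<bar>} \<inter> A" for n
  have S: "S n \<in> fmeasurable M" for n
  proof -
    let ?L = "{x \<in> space M. inverse (real (Suc n)) \<le> \<bar>f x\<bar>}"
    have "emeasure M ?L \<le> ennreal ((1 / inverse (real (Suc n))) * (LINT x|M. \<bar>f x\<bar>))"
      using f by (intro integral_Markov_inequality) auto
    also have "\<dots> < \<infinity>" by simp
    finally have "?L \<in> fmeasurable M" by (intro fmeasurableI) auto
    then show ?thesis unfolding S_def by (rule fmeasurable_Int_fmeasurable) measurable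
  qed
  have "\<exists>n. 0 < measure M (S n)"
  proof (rule ccontr)
    assume "\<not> ?thesis"
    then have "measure M (S n) = 0" for n using measure_nonneg[of M "S n"] by (metis order_less_le)
    then have "S n \<in> null_sets M" for n using S[of n] by (auto simp: null_sets_def emeasure_eq_measure2)
    then have "AE x in M. x \<notin> (\<Union>n. S n)" by (intro AE_not_in null_sets_UN) auto
    then have "AE x in M. f x * ?g x = 0"
      using AE_space
    proof eventually_elim
      case (elim x)
      show ?case
      proof (rule ccontr)
        assume "f x * ?g x \<noteq> 0"
        then have x: "x \<in> A" "0 < \<bar>f x\<bar>" by (auto simp: indicator_def split: if_splits)
        obtain n where "inverse (real (Suc n)) < \<bar>f x\<bar>"
          using reals_Archimedean[OF x(2)] by blast
        then have "x \<in> S n" using x(1) elim(2) by (simp add: S_def less_imp_le del: of_nat_Suc)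
        then show False using elim by blast
      qed
    qed
    then have "(LINT x|M. f x * ?g x) = 0" by (rule integral_eq_zero_AE)
    then show False using pos by simp
  qed
  then obtain n where "0 < measure M (S n)" by blast
  then show "\<exists>B\<in>fmeasurable M. B \<subseteq> A \<and> 0 < measure M B"
    using S by (intro bexI[of _ "S n"]) (auto simp: S_def)
qed

text \<open>
  A subset of an atom that has finite positive measure is all of the atom up to a null set.
\<close>

lemma atom_finite:
  assumes "semifinite M" "atom M A"
  shows "A \<in> fmeasurable M" "0 < measure M A"
proof -
  obtain B where B: "B \<in> fmeasurable M" "B \<subseteq> A" "0 < measure M B"
    using assms unfolding semifinite_def atom_def by blast
  then have "emeasure M B \<noteq> 0" by (auto simp: emeasure_eq_measure2)
  then have "emeasure M (A - B) = 0" using assms(2) B unfolding atom_def by (metis fmeasurableD)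
  moreover have "A - B \<in> sets M" using assms(2) B(1) unfolding atom_def by auto
  ultimately have "A - B \<in> fmeasurable M" by (intro fmeasurableI) auto
  then have "B \<union> (A - B) \<in> fmeasurable M" using B(1) by (intro fmeasurable.Un)
  then show A: "A \<in> fmeasurable M" using B(2) by (simp add: Un_absorb1)
  then show "0 < measure M A" using assms(2) by (auto simp: atom_def emeasure_eq_measure2)
qed

text \<open>
  The zero measure has no atoms, but its L1 is trivial; the dimension hypothesis serves to exclude it.
\<close>

lemma fin_dim_L1_if_null:
  assumes "emeasure M (space M) = 0"
  shows "fin_dim (L1 M) (vecs (L1 M))"
proof -
  have null: "AE x in M. f x = (0::real)" for f
    using assms by (intro AE_I[of _ _ "space M"]) auto
  have "u = vzero (L1 M)" if u: "u \<in> vecs (L1 M)" for u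
  proof -
    obtain f where f: "integrable M f" "u = ae_class M f" using u by (rule L1_vecsE)
    then show ?thesis using null[of f] by (simp add: L1_def ae_class_eq_iff)
  qed
  then have vecs: "vecs (L1 M) = {vzero (L1 M)}" using L1.zero_closed by blast
  have "lin_span (L1 M) {} = vecs (L1 M)"
  proof
    show "lin_span (L1 M) {} \<subseteq> vecs (L1 M)"
      using L1.lin_subspace_span[of "{}" M] unfolding lin_subspace_def by simp
    show "vecs (L1 M) \<subseteq> lin_span (L1 M) {}"
      using L1.lin_subspace_span[of "{}" M] unfolding lin_subspace_def vecs by simp
  qed
  then show ?thesis unfolding fin_dim_def by (intro exI[of _ "{}"]) auto
qed

section \<open>The geometry of an atom\<close>

text \<open>
  A function \<open>f\<close> in the unit ball with integral \<open>t\<close> over \<open>A\<close> equals \<open>t / measure M A\<close> there. Its distance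
  from the normalized indicator is therefore \<open>\<bar>t - 1\<bar>\<close> on \<open>A\<close>, plus the norm of \<open>f\<close> off \<open>A\<close>, which is at
  most \<open>1 - \<bar>t\<bar>\<close>.
\<close>

lemma sharply_exposed_if_atom:
  assumes M: "localizable M" and A: "atom M A"
  shows "L1.sharply_exposed M (canonical_duality M (ae_class M (indicator A)))
    (ae_class M (\<lambda>x. indicator A x / measure M A))"
proof -
  let ?m = "measure M A" and ?I = "indicator A :: 'a \<Rightarrow> real"
  let ?p = "canonical_duality M (ae_class M ?I)" and ?x = "ae_class M (\<lambda>x. ?I x / ?m)"
  have fin: "A \<in> fmeasurable M" "0 < ?m" using atom_finite[OF semifinite_if_localizable[OF M] A] by auto
  have AM [measurable]: "A \<in> sets M" and pos: "0 < emeasure M A" using A by (auto simp: atom_def)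
  have I: "integrable M ?I" "(LINT x|M. ?I x) = ?m" using fin by (simp_all add: fmeasurable_def)
  have p: "?p \<in> unit_sphere (dual_space (L1 M))"
    using canonical_duality_vecs[OF M indicator_Linf[OF AM]]
      canonical_duality_norm[OF M indicator_Linf[OF AM]] norm_indicator_Linf[OF AM pos]
    by (simp add: unit_sphere_def)
  have p_eq: "?p (ae_class M f) = (LINT x|M. ?I x * f x)" if "integrable M f" for f
    using canonical_duality_ae_class[OF that, of ?I] by (simp add: mult.commute)
  have Im: "integrable M (\<lambda>x. ?I x / ?m)" using I by simp
  have x: "?x \<in> vecs (L1 M)" using Im by (rule L1_vecs)
  have xnorm: "vnorm (L1 M) ?x = 1" using I fin by (simp add: L1_norm)
  have "(\<lambda>x. ?I x * (?I x / ?m)) = (\<lambda>x. ?I x / ?m)" by (auto simp: indicator_def)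
  then have px: "?p ?x = 1" using I fin by (simp add: p_eq[OF Im])
  have near: "vnorm (L1 M) (vsub (L1 M) y ?x) \<le> 2 * (1 - ?p y)" if y: "y \<in> unit_ball (L1 M)" for y
  proof -
    note yv = L1.ball_vecs[OF y]
    obtain f where f: "integrable M f" "y = ae_class M f" using yv by (rule L1_vecsE)
    have fm [measurable]: "f \<in> borel_measurable M" using f by simp
    define t where "t = ?p y"
    have t: "t = (LINT x|M. ?I x * f x)" using f by (simp add: t_def p_eq)
    have If: "integrable M (\<lambda>x. ?I x * f x)" using integrable_mult_indicator[OF AM f(1)] by simp
    have const: "AE x in M. x \<in> A \<longrightarrow> f x = t / ?m"
      using AE_const_on_atom[OF A fin(1) fm If] by (simp add: t)
    have "t \<le> 1" using L1.dual_sphere_bound[OF p yv] y by (simp add: t_def unit_ball_def abs_le_iff)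
    have "vnorm (L1 M) (vsub (L1 M) y ?x) = (LINT x|M. \<bar>f x - ?I x / ?m\<bar>)"
      by (simp add: f(2) L1_sub L1_norm)
    also have "\<dots> = (LINT x|M. \<bar>f x\<bar> + (\<bar>t - 1\<bar> - \<bar>t\<bar>) / ?m * ?I x)"
    proof (intro integral_cong_AE)
      show "AE x in M. \<bar>f x - ?I x / ?m\<bar> = \<bar>f x\<bar> + (\<bar>t - 1\<bar> - \<bar>t\<bar>) / ?m * ?I x"
        using const
      proof eventually_elim
        case (elim x)
        show ?case
        proof (cases "x \<in> A")
          case True
          then have fx: "f x = t / ?m" using elim by simp
          have "\<bar>t / ?m - 1 / ?m\<bar> = \<bar>t - 1\<bar> / ?m"
            using fin(2) by (simp add: diff_divide_distrib[symmetric])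
          then show ?thesis using True fin(2) by (simp add: fx diff_divide_distrib)
        qed simp
      qed
    qed measurable
    also have "\<dots> = (LINT x|M. \<bar>f x\<bar>) + (\<bar>t - 1\<bar> - \<bar>t\<bar>)"
      using f(1) I fin(2) by simp
    finally have eq: "vnorm (L1 M) (vsub (L1 M) y ?x) = (LINT x|M. \<bar>f x\<bar>) + (\<bar>t - 1\<bar> - \<bar>t\<bar>)" .
    have "(LINT x|M. \<bar>f x\<bar>) \<le> 1" using y by (simp add: f(2) unit_ball_def L1_norm)
    then show ?thesis using \<open>t \<le> 1\<close> unfolding eq t_def[symmetric] right_diff_distrib by linarith
  qed
  show ?thesis
    unfolding L1.sharply_exposed_def using p x xnorm px near by (simp add: unit_ball_def)
qed

text \<open>
  The coordinate \<open>q\<close> is the average over the atom, which is the almost everywhere constant value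
  there; what remains after subtracting it from the function lives off the atom.
\<close>

lemma line_max_summand_if_atom:
  assumes M: "semifinite M" and A: "atom M A"
  shows "\<exists>q. Linf.line_max_summand M q (ae_class M (indicator A))"
proof -
  let ?m = "measure M A" and ?I = "indicator A :: 'a \<Rightarrow> real"
  let ?v = "ae_class M ?I"
  have fin: "A \<in> fmeasurable M" "0 < ?m" using atom_finite[OF M A] by auto
  have AM [measurable]: "A \<in> sets M" and pos: "0 < emeasure M A" using A by (auto simp: atom_def)
  have I: "integrable M ?I" "(LINT x|M. ?I x) = ?m" using fin by (simp_all add: fmeasurable_def)
  define q where "q = (\<lambda>u\<in>vecs (Linf M). (LINT x|M. ?I x * rep u x) / ?m)"
  have int: "integrable M (\<lambda>x. ?I x * f x)"
    if "f \<in> borel_measurable M" "ae_class M f \<in> vecs (Linf M)" for f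
    using integrable_mult_AE_bounded[OF I(1) that(1) Linf_norm_AE[OF that]] .
  have q: "q (ae_class M f) = (LINT x|M. ?I x * f x) / ?m"
    if f: "f \<in> borel_measurable M" "ae_class M f \<in> vecs (Linf M)" for f
  proof -
    note [measurable] = f(1) rep_ae_class(1)[OF f(1)]
    have "AE x in M. ?I x * rep (ae_class M f) x = ?I x * f x"
      using rep_ae_class(2)[OF f(1)] by eventually_elim simp
    then have "(LINT x|M. ?I x * rep (ae_class M f) x) = (LINT x|M. ?I x * f x)"
      by (intro integral_cong_AE) measurable
    then show ?thesis using f by (simp add: q_def)
  qed
  have const: "AE x in M. x \<in> A \<longrightarrow> f x = q (ae_class M f)"
    if f: "f \<in> borel_measurable M" "ae_class M f \<in> vecs (Linf M)" for f
    using AE_const_on_atom[OF A fin(1) f(1) int[OF f]] by (simp add: q[OF f])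
  have q_le: "\<bar>q (ae_class M f)\<bar> \<le> vnorm (Linf M) (ae_class M f)"
    if f: "f \<in> borel_measurable M" "ae_class M f \<in> vecs (Linf M)" for f
  proof (rule Linf_norm_geI[OF f AM pos])
    show "AE x in M. x \<in> A \<longrightarrow> \<bar>q (ae_class M f)\<bar> \<le> \<bar>f x\<bar>"
      using const[OF f] by eventually_elim auto
  qed
  have "q \<in> vecs (dual_space (Linf M))"
    unfolding Linf.dual_iff
  proof (intro conjI ballI allI exI)
    show "q \<in> extensional (vecs (Linf M))" by (simp add: q_def)
    fix u assume u: "u \<in> vecs (Linf M)"
    obtain f where f: "f \<in> borel_measurable M" "u = ae_class M f" using u by (rule Linf_vecsE)
    show "\<bar>q u\<bar> \<le> 1 * vnorm (Linf M) u" using q_le f u by simp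
    fix c
    have cu: "vscale (Linf M) c u \<in> vecs (Linf M)" using u by simp
    show "q (vscale (Linf M) c u) = c * q u"
      using cu f u by (simp add: Linf_scale q mult.left_commute)
  next
    fix u v assume uv: "u \<in> vecs (Linf M)" "v \<in> vecs (Linf M)"
    obtain f where f: "f \<in> borel_measurable M" "u = ae_class M f" using uv(1) by (rule Linf_vecsE)
    obtain g where g: "g \<in> borel_measurable M" "v = ae_class M g" using uv(2) by (rule Linf_vecsE)
    have "vadd (Linf M) u v \<in> vecs (Linf M)" using uv by simp
    then show "q (vadd (Linf M) u v) = q u + q v"
      using f g uv int[of f] int[of g] by (simp add: Linf_add q distrib_left add_divide_distrib)
  qed
  moreover have v: "?v \<in> vecs (Linf M)" by (rule indicator_Linf[OF AM])
  moreover have "q ?v = 1"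
  proof -
    have "(\<lambda>x. ?I x * ?I x) = ?I" by (auto simp: indicator_def)
    then show ?thesis using q[OF _ v] I fin by simp
  qed
  moreover have "vnorm (Linf M) y = max \<bar>q y\<bar> (vnorm (Linf M) (vsub (Linf M) y (vscale (Linf M) (q y) ?v)))"
    if y: "y \<in> vecs (Linf M)" for y
  proof -
    obtain f where f: "f \<in> borel_measurable M" "y = ae_class M f" "AE x in M. \<bar>f x\<bar> \<le> vnorm (Linf M) y"
      using y by (rule Linf_vecsE)
    note [measurable] = f(1)
    let ?h = "\<lambda>x. f x - q y * ?I x"
    have diff: "vsub (Linf M) y (vscale (Linf M) (q y) ?v) = ae_class M ?h"
      by (simp add: f(2) Linf_scale Linf_sub)
    have h: "?h \<in> borel_measurable M" "ae_class M ?h \<in> vecs (Linf M)"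
      using y v by (measurable, simp add: diff[symmetric])
    have c: "AE x in M. x \<in> A \<longrightarrow> f x = q y" using const[OF f(1)] y f(2) by simp
    have "vnorm (Linf M) (ae_class M f) \<le> max \<bar>q y\<bar> (vnorm (Linf M) (ae_class M ?h))"
    proof (rule Linf_norm_leI[OF f(1)])
      show "AE x in M. \<bar>f x\<bar> \<le> max \<bar>q y\<bar> (vnorm (Linf M) (ae_class M ?h))"
        using c Linf_norm_AE[OF h]
      proof eventually_elim
        case (elim x)
        then show ?case by (cases "x \<in> A") auto
      qed
    qed simp
    moreover have "vnorm (Linf M) (ae_class M ?h) \<le> vnorm (Linf M) y"
    proof (rule Linf_norm_leI[OF h(1)])
      show "AE x in M. \<bar>?h x\<bar> \<le> vnorm (Linf M) y"
        using c f(3)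
      proof eventually_elim
        case (elim x)
        then show ?case using Linf.norm_nonneg[OF y] by (cases "x \<in> A") auto
      qed
    qed (use Linf.norm_nonneg[OF y] in simp)
    moreover have "\<bar>q y\<bar> \<le> vnorm (Linf M) y" using q_le f y by simp
    ultimately show ?thesis unfolding diff using f(2) by simp
  qed
  ultimately show ?thesis unfolding Linf.line_max_summand_def by blast
qed

section \<open>L1 over an atomless measure\<close>

definition bump :: "'a measure \<Rightarrow> 'a set \<Rightarrow> real \<Rightarrow> 'a \<Rightarrow> real" where
  "bump M B s x = s * indicator B x / measure M B"

lemma
  assumes B: "B \<in> fmeasurable M" "0 < measure M B" and s: "\<bar>s\<bar> = 1"
  shows integrable_bump: "integrable M (bump M B s)"
    and "\<bar>bump M B s x\<bar> = indicator B x / measure M B"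
    and integral_abs_bump: "(LINT x|M. \<bar>bump M B s x\<bar>) = 1"
    and bump_sphere: "ae_class M (bump M B s) \<in> unit_sphere (L1 M)"
proof -
  have I: "integrable M (\<lambda>x. indicator B x :: real)" "(LINT x|M. indicator B x) = measure M B"
    using B by (simp_all add: fmeasurable_def)
  show int: "integrable M (bump M B s)" unfolding bump_def using I(1) by simp
  show abs: "\<bar>bump M B s x\<bar> = indicator B x / measure M B" for x
    using s B(2) by (simp add: bump_def abs_mult)
  show one: "(LINT x|M. \<bar>bump M B s x\<bar>) = 1" unfolding abs using I B(2) by simp
  show "ae_class M (bump M B s) \<in> unit_sphere (L1 M)"
    using int one by (simp add: unit_sphere_def L1_vecs L1_norm)
qed

text \<open>
  Testing against a normalized signed indicator averages the function over the set.
\<close>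

lemma canonical_duality_bump_ge:
  assumes B: "B \<in> fmeasurable M" "0 < measure M B" and s: "\<bar>s\<bar> = 1"
    and g: "g \<in> borel_measurable M" "ae_class M g \<in> vecs (Linf M)"
    and ge: "\<And>x. x \<in> B \<Longrightarrow> c \<le> s * g x"
  shows "c \<le> canonical_duality M (ae_class M g) (ae_class M (bump M B s))"
proof -
  have I: "integrable M (\<lambda>x. indicator B x :: real)" "(LINT x|M. indicator B x) = measure M B"
    using B by (simp_all add: fmeasurable_def)
  have "c = (LINT x|M. c / measure M B * indicator B x)" using I B(2) by simp
  also have "\<dots> \<le> (LINT x|M. bump M B s x * g x)"
  proof (rule integral_mono)
    show "integrable M (\<lambda>x. bump M B s x * g x)"
      using integrable_mult_AE_bounded[OF integrable_bump[OF B s] g(1) Linf_norm_AE[OF g]] .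
    show "c / measure M B * indicator B x \<le> bump M B s x * g x" for x
      using divide_right_mono[OF ge, of x "measure M B"] B(2)
      by (cases "x \<in> B") (simp_all add: bump_def)
  qed (use I in simp)
  also have "\<dots> = canonical_duality M (ae_class M g) (ae_class M (bump M B s))"
    using canonical_duality_ae_class[OF integrable_bump[OF B s] g(1)] by simp
  finally show ?thesis .
qed

text \<open>
  One disjoint set is reserved for every pair of a functional and a precision. The sign function \<open>h\<close>
  agrees on each of them with the sign that the functional has there, so it is 1 at all the bumps
  simultaneously.
\<close>

lemma one_ASD2P_omega_L1_if_atomless:
  assumes M: "localizable M" "atomless M" "0 < emeasure M (space M)"
  shows "one_ASD2P_omega (L1 M)"
  unfolding one_ASD2P_omega_def
proof (intro allI impI, elim conjE)
  fix A :: "(('a \<Rightarrow> real) set \<Rightarrow> real) set"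
  assume A: "countable A" "A \<subseteq> unit_sphere (dual_space (L1 M))"
  note sf = semifinite_if_localizable[OF M(1)]
  let ?p1 = "canonical_duality M (ae_class M (indicator (space M)))"
  have p1: "?p1 \<in> unit_sphere (dual_space (L1 M))"
    using canonical_duality_vecs[OF M(1) indicator_Linf[OF sets.top]]
      canonical_duality_norm[OF M(1) indicator_Linf[OF sets.top]] norm_indicator_Linf[OF sets.top M(3)]
    by (simp add: unit_sphere_def)
  \<comment> \<open>The extra functional makes the enumerated set nonempty.\<close>
  define P where "P = from_nat_into (insert ?p1 A)"
  have P_range: "range P = insert ?p1 A" unfolding P_def using A(1) by (intro range_from_nat_into) auto
  have "insert ?p1 A \<subseteq> unit_sphere (dual_space (L1 M))" using A(2) p1 by (rule insert_subsetI[rotated])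
  then have P: "P i \<in> unit_sphere (dual_space (L1 M))" for i
    using rangeI[of P i] unfolding P_range by (rule subsetD)
  have "\<exists>g. g \<in> borel_measurable M \<and> ae_class M g \<in> vecs (Linf M) \<and>
      P i = canonical_duality M (ae_class M g) \<and> vnorm (Linf M) (ae_class M g) = 1" for i
  proof -
    have "P i \<in> vecs (dual_space (L1 M))" "vnorm (dual_space (L1 M)) (P i) = 1"
      using P[of i] by (simp_all add: unit_sphere_def)
    then show ?thesis using dual_L1_E[OF M(1), of "P i"] by metis
  qed
  then obtain g where g: "\<And>i. g i \<in> borel_measurable M" "\<And>i. ae_class M (g i) \<in> vecs (Linf M)"
    "\<And>i. P i = canonical_duality M (ae_class M (g i))" "\<And>i. vnorm (Linf M) (ae_class M (g i)) = 1"
    by metis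
  \<comment> \<open>The index \<open>n\<close> codes a functional \<open>d n\<close> and a precision.\<close>
  define c where "c n = 1 - inverse (real (Suc (snd (prod_decode n))))" for n
  define d where "d n = fst (prod_decode n)" for n
  have "\<exists>s S. \<bar>s\<bar> = 1 \<and> S \<in> sets M \<and> 0 < emeasure M S \<and> (\<forall>x\<in>S. c n < s * g (d n) x)" for n
  proof -
    have "c n < vnorm (Linf M) (ae_class M (g (d n)))" by (simp add: g c_def)
    from Linf_nearly_attained[OF g(1) g(2) M(3) this] show ?thesis by metis
  qed
  then obtain s S where s: "\<And>n. \<bar>s n\<bar> = 1" and S: "\<And>n. S n \<in> sets M" "\<And>n. 0 < emeasure M (S n)"
    and big: "\<And>n x. x \<in> S n \<Longrightarrow> c n < s n * g (d n) x" by metis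
  obtain B h where B: "\<And>n. B n \<in> fmeasurable M" "\<And>n. B n \<subseteq> S n" "\<And>n. 0 < measure M (B n)"
    and h: "h \<in> borel_measurable M" "\<And>x. \<bar>h x\<bar> \<le> 1" "\<And>n x. x \<in> B n \<Longrightarrow> h x = s n"
    using disjoint_sign_pattern[of M S s, OF M(2) sf S s] by blast
  define F where "F n = ae_class M (bump M (B n) (s n))" for n
  let ?q = "canonical_duality M (ae_class M h)"
  have F: "F n \<in> unit_sphere (L1 M)" for n unfolding F_def using B s by (intro bump_sphere)
  have hv: "ae_class M h \<in> vecs (Linf M)" using h by (intro Linf_vecs[of _ _ 1]) auto
  have qv: "?q \<in> vecs (dual_space (L1 M))" by (rule canonical_duality_vecs[OF M(1) hv])
  have "s n * s n = 1" for n using abs_mult_self_eq[of "s n"] s[of n] by simp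
  then have q_ge: "1 \<le> ?q (F n)" for n
    unfolding F_def by (intro canonical_duality_bump_ge B s h(1) hv) (simp add: h(3))
  have "vnorm (dual_space (L1 M)) ?q = 1"
  proof (rule antisym)
    show "vnorm (dual_space (L1 M)) ?q \<le> 1"
      unfolding canonical_duality_norm[OF M(1) hv] using h by (intro Linf_norm_leI) auto
    show "1 \<le> vnorm (dual_space (L1 M)) ?q"
      using L1.dual_bound[OF qv, of "F 0"] F[of 0] q_ge[of 0] by (simp add: unit_sphere_def)
  qed
  then have q: "?q \<in> unit_sphere (dual_space (L1 M))" using qv by (simp add: unit_sphere_def)
  have q_eq: "?q (F n) = 1" for n
    using L1.dual_sphere_bound[OF q, of "F n"] F[of n] q_ge[of n] by (simp add: unit_sphere_def)
  have "norms_functionals (L1 M) (range F) A"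
    unfolding norms_functionals_def
  proof (intro allI impI, elim conjE)
    fix r :: real and p assume r: "0 < r" "r < 1" and p: "p \<in> A"
    obtain i where i: "p = P i" using p P_range by (metis imageE insertI2)
    obtain k where "inverse (real (Suc k)) < 1 - r" using reals_Archimedean[of "1 - r"] r by auto
    then have k: "r \<le> c (prod_encode (i, k))" by (simp add: c_def)
    let ?n = "prod_encode (i, k)"
    have "c ?n \<le> canonical_duality M (ae_class M (g (d ?n))) (F ?n)"
      unfolding F_def using B(2)[of ?n] big[of _ ?n]
      by (intro canonical_duality_bump_ge B s g) (auto intro: less_imp_le)
    then have "r \<le> p (F ?n)" using k by (simp add: i g(3)[symmetric] d_def)
    moreover have "F ?n \<noteq> vzero (L1 M)" "vnorm (L1 M) (F ?n) = 1"
      using F[of ?n] by (auto simp: unit_sphere_def)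
    moreover have "vnorm (dual_space (L1 M)) p = 1" using p A(2) by (auto simp: unit_sphere_def)
    ultimately show "\<exists>x\<in>range F - {vzero (L1 M)}. r * vnorm (dual_space (L1 M)) p * vnorm (L1 M) x \<le> p x"
      by (intro bexI[of _ "F ?n"]) simp_all
  qed
  then show "\<exists>B p. B \<subseteq> unit_sphere (L1 M) \<and> p \<in> unit_sphere (dual_space (L1 M)) \<and>
      norms_functionals (L1 M) B A \<and> (\<forall>x\<in>B. p x = 1)"
    using F q q_eq by (intro exI[of _ "range F"] exI[of _ ?q]) auto
qed

text \<open>
  A bump supported on a set \<open>B\<close> inside the region where the functional is almost attained lies in the
  slice. If \<open>u\<close> has little mass on \<open>B\<close>, the bump and \<open>u\<close> are almost disjoint and their norms almost
  add up.
\<close>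

lemma Daugavet_L1_if_atomless:
  assumes M: "localizable M" "atomless M" "0 < emeasure M (space M)"
  shows "Daugavet (L1 M)"
proof (rule L1.DaugavetI)
  fix p u and e :: real
  assume p: "p \<in> unit_sphere (dual_space (L1 M))" and u: "u \<in> vecs (L1 M)" and e: "0 < e"
  have pv: "p \<in> vecs (dual_space (L1 M))" "vnorm (dual_space (L1 M)) p = 1"
    using p by (simp_all add: unit_sphere_def)
  obtain g where g: "g \<in> borel_measurable M" "ae_class M g \<in> vecs (Linf M)"
    "p = canonical_duality M (ae_class M g)" "vnorm (Linf M) (ae_class M g) = 1"
    using dual_L1_E[OF M(1) pv(1)] pv(2) by metis
  obtain h where h: "integrable M h" "u = ae_class M h" using u by (rule L1_vecsE)
  obtain s A where s: "\<bar>s\<bar> = 1" and A: "A \<in> sets M" "0 < emeasure M A"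
    and big: "\<And>x. x \<in> A \<Longrightarrow> 1 - e < s * g x"
    using Linf_nearly_attained[OF g(1,2) M(3), of "1 - e"] g(4) e by auto
  obtain B where B: "\<And>n::nat. B n \<in> fmeasurable M" "\<And>n. B n \<subseteq> A" "\<And>n. 0 < measure M (B n)"
    "disjoint_family B"
    using disjoint_refinement[of M "\<lambda>_. A", OF M(2) semifinite_if_localizable[OF M(1)] A] by blast
  obtain n where n: "(LINT x|M. indicator (B n) x * \<bar>h x\<bar>) < e / 2"
    using small_integral_on_disjoint_sets[OF h(1), of B "e / 2"] B e by auto
  let ?b = "bump M (B n) s"
  note b = integrable_bump[OF B(1,3) s, of n]
  have hb: "integrable M (\<lambda>x. indicator (B n) x * \<bar>h x\<bar>)"
    using integrable_mult_indicator[of "B n" M "\<lambda>x. \<bar>h x\<bar>"] B(1) h(1) by auto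
  have "1 + vnorm (L1 M) u - e \<le> (LINT x|M. \<bar>?b x\<bar>) + (LINT x|M. \<bar>h x\<bar>)
      - 2 * (LINT x|M. indicator (B n) x * \<bar>h x\<bar>)"
    using n integral_abs_bump[OF B(1,3) s, of n] h by (simp add: L1_norm)
  also have "\<dots> = (LINT x|M. \<bar>?b x\<bar> + \<bar>h x\<bar> - 2 * (indicator (B n) x * \<bar>h x\<bar>))"
    using b h hb by simp
  also have "\<dots> \<le> (LINT x|M. \<bar>?b x + h x\<bar>)"
  proof (rule integral_mono)
    show "\<bar>?b x\<bar> + \<bar>h x\<bar> - 2 * (indicator (B n) x * \<bar>h x\<bar>) \<le> \<bar>?b x + h x\<bar>" for x
      by (cases "x \<in> B n") (auto simp: bump_def)
  qed (use b h hb in auto)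
  also have "\<dots> = vnorm (L1 M) (vadd (L1 M) (ae_class M ?b) u)"
    using b h by (simp add: L1_add L1_norm)
  finally have "1 + vnorm (L1 M) u - e \<le> vnorm (L1 M) (vadd (L1 M) (ae_class M ?b) u)" .
  moreover have "1 - e \<le> p (ae_class M ?b)"
    unfolding g(3) using B(2)[of n] big
    by (intro canonical_duality_bump_ge B s g) (auto intro: less_imp_le)
  moreover have "ae_class M ?b \<in> unit_ball (L1 M)"
    using bump_sphere[OF B(1,3) s, of n] by (simp add: unit_sphere_def unit_ball_def)
  ultimately show "\<exists>x\<in>unit_ball (L1 M). 1 - e \<le> p x \<and>
      1 + vnorm (L1 M) u - e \<le> vnorm (L1 M) (vadd (L1 M) x u)" by (intro bexI conjI)
qed

section \<open>Linf over an atomless measure\<close>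

text \<open>
  Restricted to disjoint sets and with signs chosen to make the values of \<open>p\<close> nonnegative, the pieces
  of \<open>w\<close> add up to functions that are still bounded by \<open>C\<close>. So the sums of the absolute values are
  bounded by \<open>\<parallel>p\<parallel> * C\<close> independently of the number of pieces. Here \<open>p\<close> is any bounded functional
  on Linf, not necessarily given by an integrable function.
\<close>

lemma functional_small_on_disjoint_sets:
  assumes p: "p \<in> vecs (dual_space (Linf M))" and w: "w \<in> borel_measurable M" "AE x in M. \<bar>w x\<bar> \<le> C"
    and B: "\<And>n::nat. B n \<in> sets M" "disjoint_family B" and e: "0 < e"
  shows "\<exists>n. \<bar>p (ae_class M (\<lambda>x. indicator (B n) x * w x))\<bar> < e"
proof (rule ccontr)
  let ?H = "\<lambda>n x. indicator (B n) x * w x"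
  note [measurable] = w(1) B(1)
  assume "\<not> ?thesis"
  then have ge: "e \<le> \<bar>p (ae_class M (?H n))\<bar>" for n by (simp add: not_less)
  define s where "s n = sgn (p (ae_class M (?H n)))" for n
  define G where "G N x = (\<Sum>n<N. s n * ?H n x)" for N x
  have Gm [measurable]: "G N \<in> borel_measurable M" for N unfolding G_def by measurable
  have G_bound: "AE x in M. \<bar>G N x\<bar> \<le> \<bar>C\<bar>" for N
    using w(2)
  proof eventually_elim
    case (elim x)
    have "G N x = (\<Sum>n<N. s n * indicator (B n) x) * w x" by (simp only: G_def sum_distrib_right mult.assoc)
    then have "\<bar>G N x\<bar> \<le> 1 * \<bar>w x\<bar>"
      using abs_signed_indicator_sum_le_one[OF B(2), of s x N]
      by (simp only: abs_mult) (intro mult_right_mono, auto simp: s_def sgn_if)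
    then show ?case using elim by linarith
  qed
  have Hv: "ae_class M (?H n) \<in> vecs (Linf M)" for n
  proof (rule Linf_vecs)
    show "AE x in M. \<bar>?H n x\<bar> \<le> \<bar>C\<bar>" using w(2) by eventually_elim (auto simp: indicator_def)
  qed measurable
  have Gv: "ae_class M (G N) \<in> vecs (Linf M)" for N using Gm G_bound by (rule Linf_vecs)
  have pG: "real N * e \<le> p (ae_class M (G N))" for N
  proof (induction N)
    case 0
    have "ae_class M (G 0) = vzero (Linf M)" by (simp add: G_def[abs_def] Linf_def)
    then show ?case using Linf.dual_scale[OF p Linf.zero_closed, of 0] by simp
  next
    case (Suc N)
    have "ae_class M (G (Suc N)) = vadd (Linf M) (ae_class M (G N)) (vscale (Linf M) (s N) (ae_class M (?H N)))"
      by (simp add: Linf_add Linf_scale) (simp add: G_def[abs_def])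
    then have "p (ae_class M (G (Suc N))) = p (ae_class M (G N)) + s N * p (ae_class M (?H N))"
      using Gv Hv by (simp add: Linf.dual_add[OF p] Linf.dual_scale[OF p])
    also have "s N * p (ae_class M (?H N)) = \<bar>p (ae_class M (?H N))\<bar>" by (simp add: s_def abs_sgn mult.commute)
    finally show ?case using Suc ge[of N] by (simp add: distrib_right)
  qed
  have "real N * e \<le> vnorm (dual_space (Linf M)) p * \<bar>C\<bar>" for N
  proof -
    have "real N * e \<le> vnorm (dual_space (Linf M)) p * vnorm (Linf M) (ae_class M (G N))"
      using pG[of N] Linf.dual_bound[OF p Gv, of N] by linarith
    also have "\<dots> \<le> vnorm (dual_space (Linf M)) p * \<bar>C\<bar>"
      using Linf_norm_leI[OF Gm G_bound] Linf.dual_norm_nonneg[OF p] by (intro mult_left_mono) auto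
    finally show ?thesis .
  qed
  moreover obtain N where "vnorm (dual_space (Linf M)) p * \<bar>C\<bar> < real N * e"
    using reals_Archimedean3[OF e] by blast
  ultimately show False by (simp add: not_less[symmetric])
qed

text \<open>
  Start with any \<open>f\<close> in the slice and overwrite it on one of many disjoint sets on which \<open>u\<close> has constant
  sign and is almost maximal. There the sum with \<open>u\<close> reaches almost \<open>1 + \<parallel>u\<parallel>\<close>, and for one of the sets
  the value of the functional hardly changes.
\<close>

lemma Daugavet_Linf_if_atomless:
  assumes M: "semifinite M" "atomless M" "0 < emeasure M (space M)"
  shows "Daugavet (Linf M)"
proof (rule Linf.DaugavetI)
  fix p u and e :: real
  assume p: "p \<in> unit_sphere (dual_space (Linf M))" and u: "u \<in> vecs (Linf M)" and e: "0 < e"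
  have pv: "p \<in> vecs (dual_space (Linf M))" "vnorm (dual_space (Linf M)) p = 1"
    using p by (simp_all add: unit_sphere_def)
  have "1 - e / 2 < vnorm (dual_space (Linf M)) p" using pv e by simp
  from Linf.dual_norm_attained_nearly[OF pv(1) this]
  obtain y where y: "y \<in> unit_ball (Linf M)" "1 - e / 2 < p y" by blast
  obtain f where f: "f \<in> borel_measurable M" "y = ae_class M f" "AE x in M. \<bar>f x\<bar> \<le> vnorm (Linf M) y"
    using Linf.ball_vecs[OF y(1)] by (rule Linf_vecsE)
  have f1: "AE x in M. \<bar>f x\<bar> \<le> 1" using f(3) by eventually_elim (use y(1) in \<open>simp add: unit_ball_def\<close>)
  obtain h where h: "h \<in> borel_measurable M" "u = ae_class M h" using u by (rule Linf_vecsE)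
  have hv: "ae_class M h \<in> vecs (Linf M)" using u h by simp
  have "vnorm (Linf M) u - e < vnorm (Linf M) (ae_class M h)" using h e by simp
  from Linf_nearly_attained[OF h(1) hv M(3) this]
  obtain s A where s: "\<bar>s\<bar> = 1" and A: "A \<in> sets M" "0 < emeasure M A"
    and big: "\<And>x. x \<in> A \<Longrightarrow> vnorm (Linf M) u - e < s * h x" by metis
  obtain B where B: "\<And>n::nat. B n \<in> fmeasurable M" "\<And>n. B n \<subseteq> A" "\<And>n. 0 < measure M (B n)"
    "disjoint_family B"
    using disjoint_refinement[of M "\<lambda>_. A", OF M(2,1) A] by blast
  have Bs: "B n \<in> sets M" for n using B(1) by auto
  note [measurable] = f(1) h(1) Bs
  have w: "(\<lambda>x. s - f x) \<in> borel_measurable M" "AE x in M. \<bar>s - f x\<bar> \<le> 2"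
  proof -
    show "(\<lambda>x. s - f x) \<in> borel_measurable M" by measurable
    show "AE x in M. \<bar>s - f x\<bar> \<le> 2" using f1 by eventually_elim (use s in linarith)
  qed
  have e2: "0 < e / 2" using e by simp
  obtain n where n: "\<bar>p (ae_class M (\<lambda>x. indicator (B n) x * (s - f x)))\<bar> < e / 2"
    using functional_small_on_disjoint_sets[OF pv(1) w Bs B(4) e2] by blast
  let ?H = "\<lambda>x. indicator (B n) x * (s - f x)"
  let ?F = "\<lambda>x. f x + ?H x"
  have Hv: "ae_class M ?H \<in> vecs (Linf M)"
  proof (rule Linf_vecs)
    show "AE x in M. \<bar>?H x\<bar> \<le> 2" using w(2) by eventually_elim (auto simp: indicator_def)
  qed measurable
  have F: "ae_class M ?F = vadd (Linf M) y (ae_class M ?H)" by (simp add: f(2) Linf_add)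
  have Fv: "ae_class M ?F \<in> vecs (Linf M)" unfolding F using Hv Linf.ball_vecs[OF y(1)] by simp
  have "vnorm (Linf M) (ae_class M ?F) \<le> 1"
  proof (rule Linf_norm_leI)
    show "AE x in M. \<bar>?F x\<bar> \<le> 1" using f1 by eventually_elim (use s in \<open>auto simp: indicator_def\<close>)
  qed simp_all
  then have ball: "ae_class M ?F \<in> unit_ball (Linf M)" using Fv by (simp add: unit_ball_def)
  have "p (ae_class M ?F) = p y + p (ae_class M ?H)"
    unfolding F using Hv Linf.ball_vecs[OF y(1)] by (rule_tac Linf.dual_add[OF pv(1)])
  then have "1 - e \<le> p (ae_class M ?F)" using y(2) n by linarith
  moreover have "1 + vnorm (Linf M) u - e \<le> vnorm (Linf M) (vadd (Linf M) (ae_class M ?F) u)"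
  proof -
    have eq: "vadd (Linf M) (ae_class M ?F) u = ae_class M (\<lambda>x. ?F x + h x)" by (simp add: h(2) Linf_add)
    have "ae_class M (\<lambda>x. ?F x + h x) \<in> vecs (Linf M)" unfolding eq[symmetric] using Fv u by simp
    moreover have "1 + vnorm (Linf M) u - e \<le> \<bar>?F x + h x\<bar>" if x: "x \<in> B n" for x
    proof -
      have "s = 1 \<or> s = -1" using s by linarith
      then show ?thesis using big[of x] B(2)[of n] x by (elim disjE) auto
    qed
    moreover have "0 < emeasure M (B n)" using B(1,3)[of n] by (simp add: emeasure_eq_measure2)
    ultimately show ?thesis unfolding eq by (intro Linf_norm_geI[OF _ _ Bs]) auto
  qed
  ultimately show "\<exists>x\<in>unit_ball (Linf M). 1 - e \<le> p x \<and>
      1 + vnorm (Linf M) u - e \<le> vnorm (Linf M) (vadd (Linf M) x u)"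
    using ball by (intro bexI conjI)
qed

text \<open>
  The sign function \<open>g\<close> is defined so that, wherever an element of the dense set almost attains its norm,
  \<open>g\<close> takes both signs on sets of positive measure. Hence whatever the sign of \<open>l\<close>, the function and
  \<open>l * g\<close> reinforce each other somewhere.
\<close>

lemma fails_m1_BCP_omega_Linf_if_atomless:
  assumes M: "semifinite M" "atomless M" "0 < emeasure M (space M)"
  shows "fails_m1_BCP_omega (Linf M)"
  unfolding fails_m1_BCP_omega_def
proof (intro allI impI, elim conjE)
  fix Y assume Y: "lin_subspace (Linf M) Y" "separable_in (Linf M) Y"
  have Yv: "y \<in> vecs (Linf M)" if "y \<in> Y" for y using Y(1) that unfolding lin_subspace_def by blast
  obtain D where D: "countable D" "D \<subseteq> Y"
    and dense: "\<And>y e. \<lbrakk>y \<in> Y; 0 < e\<rbrakk> \<Longrightarrow> \<exists>d\<in>D. vnorm (Linf M) (vsub (Linf M) y d) < e"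
    using Y(2) unfolding separable_in_def by metis
  have "vzero (Linf M) \<in> Y" using Y(1) unfolding lin_subspace_def by blast
  then have "D \<noteq> {}" using dense[of "vzero (Linf M)" 1] by auto
  define d where "d = from_nat_into D"
  have d_range: "range d = D" unfolding d_def using \<open>D \<noteq> {}\<close> D(1) by (intro range_from_nat_into)
  have dv: "d i \<in> vecs (Linf M)" for i using d_range D(2) Yv by blast
  have "\<exists>f. f \<in> borel_measurable M \<and> d i = ae_class M f" for i
    using Linf_vecsE[OF dv[of i]] by metis
  then obtain f where f: "\<And>i. f i \<in> borel_measurable M" "\<And>i. d i = ae_class M (f i)" by metis
  have fv: "ae_class M (f i) \<in> vecs (Linf M)" for i using dv f by metis
  define c where "c i k = vnorm (Linf M) (d i) - inverse (real (Suc k))" for i k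
  have "\<exists>s A. \<bar>s\<bar> = 1 \<and> A \<in> sets M \<and> 0 < emeasure M A \<and> (\<forall>x\<in>A. c i k < s * f i x)" for i k
  proof -
    have "c i k < vnorm (Linf M) (ae_class M (f i))" by (simp add: f(2) c_def)
    from Linf_nearly_attained[OF f(1) fv M(3) this] show ?thesis by metis
  qed
  then obtain s :: "nat \<Rightarrow> nat \<Rightarrow> real" and A where s: "\<And>i k. \<bar>s i k\<bar> = 1"
    and A: "\<And>i k. A i k \<in> sets M" "\<And>i k. 0 < emeasure M (A i k)"
    and big: "\<And>i k x. x \<in> A i k \<Longrightarrow> c i k < s i k * f i x"
    by metis
  \<comment> \<open>Index \<open>(i, k, b)\<close>: element, precision, and whether \<open>g\<close> agrees with the sign of the element.\<close>
  define A' where "A' n = (case from_nat n of (i, k, b :: bool) \<Rightarrow> A i k)" for n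
  define s' where "s' n = (case from_nat n of (i, k, b) \<Rightarrow> s i k * (if b then 1 else -1))" for n
  have A': "A' n \<in> sets M" "0 < emeasure M (A' n)" for n
    using A by (auto simp: A'_def split: prod.split)
  have s': "\<bar>s' n\<bar> = 1" for n using s by (auto simp: s'_def abs_mult split: prod.split)
  obtain B g where B: "\<And>n. B n \<in> fmeasurable M" "\<And>n. B n \<subseteq> A' n" "\<And>n. 0 < measure M (B n)"
    and g: "g \<in> borel_measurable M" "\<And>x. \<bar>g x\<bar> \<le> 1" "\<And>n x. x \<in> B n \<Longrightarrow> g x = s' n"
    using disjoint_sign_pattern[of M A' s', OF M(2,1) A' s'] by blast
  have Bs: "B n \<in> sets M" "0 < emeasure M (B n)" for n
    using B(1,3)[of n] by (auto simp: emeasure_eq_measure2)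
  let ?x = "ae_class M g"
  have x: "?x \<in> vecs (Linf M)" using g by (intro Linf_vecs[of _ _ 1]) auto
  have "vnorm (Linf M) ?x = 1"
  proof (rule antisym)
    show "vnorm (Linf M) ?x \<le> 1" using g by (intro Linf_norm_leI) auto
    show "1 \<le> vnorm (Linf M) ?x"
      using g s' by (intro Linf_norm_geI[OF g(1) x Bs, of 0]) simp
  qed
  then have sphere: "?x \<in> unit_sphere (Linf M)" using x by (simp add: unit_sphere_def)
  have on_D: "vnorm (Linf M) (d i) + \<bar>l\<bar> \<le> vnorm (Linf M) (vadd (Linf M) (d i) (vscale (Linf M) l ?x))" for i l
  proof (rule field_le_epsilon)
    fix e :: real assume "0 < e"
    then obtain k where k: "inverse (real (Suc k)) < e" using reals_Archimedean by blast
    define n where "n = to_nat (i, k, 0 \<le> l)"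
    have n: "A' n = A i k" "s' n = s i k * (if 0 \<le> l then 1 else -1)" by (simp_all add: n_def A'_def s'_def)
    have eq: "vadd (Linf M) (d i) (vscale (Linf M) l ?x) = ae_class M (\<lambda>x. f i x + l * g x)"
      using f g by (simp add: Linf_scale Linf_add)
    have v: "ae_class M (\<lambda>x. f i x + l * g x) \<in> vecs (Linf M)"
      unfolding eq[symmetric] using dv x by simp
    have "c i k + \<bar>l\<bar> \<le> \<bar>f i y + l * g y\<bar>" if y: "y \<in> B n" for y
    proof -
      have "s i k = 1 \<or> s i k = -1" using s[of i k] by linarith
      moreover have "c i k < s i k * f i y" using big y B(2)[of n] n(1) by blast
      ultimately show ?thesis using g(3)[OF y] n(2) by (elim disjE) (auto split: if_splits)
    qed
    then have "c i k + \<bar>l\<bar> \<le> vnorm (Linf M) (ae_class M (\<lambda>x. f i x + l * g x))"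
      using f g by (intro Linf_norm_geI[OF _ v Bs, of n]) auto
    then show "vnorm (Linf M) (d i) + \<bar>l\<bar> \<le> vnorm (Linf M) (vadd (Linf M) (d i) (vscale (Linf M) l ?x)) + e"
      using k unfolding eq c_def by linarith
  qed
  show "\<exists>x\<in>unit_sphere (Linf M). \<forall>y\<in>Y. \<forall>l.
      vnorm (Linf M) y + \<bar>l\<bar> \<le> vnorm (Linf M) (vadd (Linf M) y (vscale (Linf M) l x))"
  proof (intro bexI[OF _ sphere] ballI allI, rule field_le_epsilon)
    fix y l and e :: real assume y: "y \<in> Y" and e: "0 < e"
    obtain i where i: "vnorm (Linf M) (vsub (Linf M) y (d i)) < e / 2"
      using dense[OF y, of "e / 2"] e d_range by auto
    let ?z = "vscale (Linf M) l ?x"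
    have z: "?z \<in> vecs (Linf M)" using x by simp
    have "vnorm (Linf M) y \<le> vnorm (Linf M) (d i) + vnorm (Linf M) (vsub (Linf M) (d i) y)"
      using Linf.norm_add_perturb[OF Yv[OF y] dv[of i] Linf.zero_closed] Yv[OF y] dv[of i] by simp
    moreover have "vnorm (Linf M) (vadd (Linf M) (d i) ?z)
        \<le> vnorm (Linf M) (vadd (Linf M) y ?z) + vnorm (Linf M) (vsub (Linf M) y (d i))"
      by (rule Linf.norm_add_perturb[OF dv Yv[OF y] z])
    ultimately show "vnorm (Linf M) y + \<bar>l\<bar> \<le> vnorm (Linf M) (vadd (Linf M) y ?z) + e"
      using on_D[of i l] i Linf.norm_sub_commute[OF Yv[OF y] dv[of i]] by linarith
  qed
qed

section \<open>The characterization of atomless measures\<close>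

theorem corollary6p8:
  fixes M :: "'a measure"
  assumes "localizable M"
    and "\<not> fin_dim (L1 M) (vecs (L1 M))"
  shows "(atomless M \<longleftrightarrow> SD2P (L1 M)) \<and>
    (atomless M \<longleftrightarrow> one_ASD2P_omega (L1 M)) \<and>
    (atomless M \<longleftrightarrow> (\<nexists>x. strongly_exposed_point (L1 M) (unit_ball (L1 M)) x)) \<and>
    (atomless M \<longleftrightarrow> Daugavet (L1 M)) \<and>
    (atomless M \<longleftrightarrow> octahedral (Linf M)) \<and>
    (atomless M \<longleftrightarrow> fails_m1_BCP_omega (Linf M)) \<and>
    (atomless M \<longleftrightarrow> Daugavet (Linf M))"
proof (cases "atomless M")
  case True
  have M: "semifinite M" "0 < emeasure M (space M)"
    using semifinite_if_localizable assms fin_dim_L1_if_null zero_less_iff_neq_zero by blast+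
  have "one_ASD2P_omega (L1 M)" by (rule one_ASD2P_omega_L1_if_atomless[OF assms(1) True M(2)])
  moreover from this have "SD2P (L1 M)" by (rule L1.SD2P_if_one_ASD2P_omega)
  moreover have "\<nexists>x. strongly_exposed_point (L1 M) (unit_ball (L1 M)) x"
    using L1.no_strongly_exposed_if_one_ASD2P_omega[OF \<open>one_ASD2P_omega (L1 M)\<close>] by blast
  moreover have "Daugavet (L1 M)" by (rule Daugavet_L1_if_atomless[OF assms(1) True M(2)])
  moreover have "fails_m1_BCP_omega (Linf M)"
    by (rule fails_m1_BCP_omega_Linf_if_atomless[OF M(1) True M(2)])
  moreover from this have "octahedral (Linf M)" by (rule Linf.octahedral_if_fails_m1_BCP_omega)
  moreover have "Daugavet (Linf M)" by (rule Daugavet_Linf_if_atomless[OF M(1) True M(2)])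
  ultimately show ?thesis using True by blast
next
  case False
  then obtain A where A: "atom M A" by (auto simp: atomless_def)
  note exposed = sharply_exposed_if_atom[OF assms(1) A]
  obtain q where summand: "Linf.line_max_summand M q (ae_class M (indicator A))"
    using line_max_summand_if_atom[OF semifinite_if_localizable[OF assms(1)] A] by blast
  have "\<not> SD2P (L1 M)" by (rule L1.not_SD2P_if_sharply_exposed[OF exposed])
  moreover from this have "\<not> one_ASD2P_omega (L1 M)" using L1.SD2P_if_one_ASD2P_omega by blast
  moreover have "\<exists>x. strongly_exposed_point (L1 M) (unit_ball (L1 M)) x"
    using L1.strongly_exposed_if_sharply_exposed[OF exposed] by blast
  moreover have "\<not> Daugavet (L1 M)" by (rule L1.not_Daugavet_if_sharply_exposed[OF exposed])
  moreover have "\<not> octahedral (Linf M)" by (rule Linf.not_octahedral_if_line_max_summand[OF summand])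
  moreover from this have "\<not> fails_m1_BCP_omega (Linf M)" using Linf.octahedral_if_fails_m1_BCP_omega by blast
  moreover have "\<not> Daugavet (Linf M)" by (rule Linf.not_Daugavet_if_line_max_summand[OF summand])
  ultimately show ?thesis using False by blast
qed

end
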